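(* Let $a,b>0$ be such that the triple $(a,b,1)$ satisfies the triangle inequality, i.e. $a+b>1$, $a+1>b$ and $b+1>a$. Then $$D_{a,b}=\{(z_1,z_2)\in\mathbb D^2:\ |F_{a,b}(z_1,z_2)|<1\},\qquad F_{a,b}(z_1,z_2)=\frac{az_1+bz_2-z_1z_2}{az_2+bz_1-1},$$ is a Lempert domain.
   Context: $\mathbb D$ is the open unit disc in $\mathbb C$ and $\rho$ is the hyperbolic (Poincaré) distance on $\mathbb D$, $\rho(\lambda,\mu)=\operatorname{artanh}\left|\frac{\lambda-\mu}{1-\bar\lambda\mu}\right|$. Equivalently, $D_{a,b}=\{z\in\mathbb D^2:|az_1+bz_2-z_1z_2|<|bz_1+az_2-1|\}$ (so points where the denominator of $F_{a,b}$ vanishes do not belong to $D_{a,b}$). For a domain $D\subset\mathbb C^n$: the Carathéodory pseudodistance is $c_D(z,w)=\sup\{\rho(F(z),F(w)):F:D\to\mathbb D\text{ holomorphic}\}$; the Lempert function is $l_D(w,z)=\inf\{\rho(0,t):t\in\mathbb D$ and there is a holomorphic $f:\mathbb D\to D$ with $f(0)=w$, $f(t)=z\}$. A domain $D$ is taut if the family of holomorphic mappings $\mathbb D\to D$ is normal, i.e. every sequence of holomorphic mappings $\mathbb D\to D$ has a subsequence that either converges locally uniformly to a holomorphic mapping $\mathbb D\to D$ or is compactly divergent. A Lempert domain is a taut domain $D$ with $c_D\equiv l_D$. *)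

theory Defs
  imports "HOL-Complex_Analysis.Complex_Analysis"
begin

abbreviation unit_disc :: "complex set" where
  "unit_disc \<equiv> ball 0 1"

definition rho :: "complex \<Rightarrow> complex \<Rightarrow> real" where
  "rho l m = artanh (cmod ((l - m) / (1 - cnj l * m)))"

definition complex_domain :: "(complex ^ 'n) set \<Rightarrow> bool" where
  "complex_domain D \<longleftrightarrow> open D \<and> connected D \<and> D \<noteq> {}"

text \<open>
  Holomorphy in several variables is complex differentiability at every point: the
  real Frechet derivative is a complex-linear functional, with coefficient vector \<open>c\<close>.
\<close>

definition hol_on_Cn :: "(complex ^ 'n \<Rightarrow> complex) \<Rightarrow> (complex ^ 'n) set \<Rightarrow> bool" where
  "hol_on_Cn F D \<longleftrightarrow>
     (\<forall>z\<in>D. \<exists>c. (F has_derivative (\<lambda>h. \<Sum>i\<in>UNIV. c $ i * h $ i)) (at z within D))"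

definition hol_to_disc :: "(complex ^ 'n) set \<Rightarrow> (complex ^ 'n \<Rightarrow> complex) set" where
  "hol_to_disc D = {F. hol_on_Cn F D \<and> F ` D \<subseteq> unit_disc}"

definition disc_maps :: "(complex ^ 'n) set \<Rightarrow> (complex \<Rightarrow> complex ^ 'n) set" where
  "disc_maps D =
     {f. (\<forall>i. (\<lambda>t. f t $ i) holomorphic_on unit_disc) \<and> f ` unit_disc \<subseteq> D}"

text \<open>
  Both quantities take values in the extended reals, so that an unbounded supremum
  is \<open>\<infinity>\<close> and an infimum over the empty set is \<open>\<infinity>\<close>.
\<close>

definition caratheodory_dist ::
    "(complex ^ 'n) set \<Rightarrow> complex ^ 'n \<Rightarrow> complex ^ 'n \<Rightarrow> ereal" where
  "caratheodory_dist D z w = (SUP F\<in>hol_to_disc D. ereal (rho (F z) (F w)))"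

definition lempert_fun ::
    "(complex ^ 'n) set \<Rightarrow> complex ^ 'n \<Rightarrow> complex ^ 'n \<Rightarrow> ereal" where
  "lempert_fun D w z =
     (INF t\<in>{t \<in> unit_disc. \<exists>f\<in>disc_maps D. f 0 = w \<and> f t = z}. ereal (rho 0 t))"

definition loc_unif_conv_disc ::
    "(nat \<Rightarrow> complex \<Rightarrow> complex ^ 'n) \<Rightarrow> (complex \<Rightarrow> complex ^ 'n) \<Rightarrow> bool" where
  "loc_unif_conv_disc f g \<longleftrightarrow>
     (\<forall>t\<in>unit_disc. \<exists>d>0. uniform_limit (ball t d \<inter> unit_disc) f g sequentially)"

definition compactly_divergent ::
    "(complex ^ 'n) set \<Rightarrow> (nat \<Rightarrow> complex \<Rightarrow> complex ^ 'n) \<Rightarrow> bool" where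
  "compactly_divergent D f \<longleftrightarrow>
     (\<forall>K L. compact K \<and> K \<subseteq> unit_disc \<and> compact L \<and> L \<subseteq> D \<longrightarrow>
        (\<forall>\<^sub>F k in sequentially. f k ` K \<inter> L = {}))"

definition taut_domain :: "(complex ^ 'n) set \<Rightarrow> bool" where
  "taut_domain D \<longleftrightarrow> complex_domain D \<and>
     (\<forall>f :: nat \<Rightarrow> complex \<Rightarrow> complex ^ 'n. (\<forall>k. f k \<in> disc_maps D) \<longrightarrow>
        (\<exists>r. strict_mono r \<and>
           ((\<exists>g\<in>disc_maps D. loc_unif_conv_disc (f \<circ> r) g) \<or>
            compactly_divergent D (f \<circ> r))))"

definition lempert_domain :: "(complex ^ 'n) set \<Rightarrow> bool" where
  "lempert_domain D \<longleftrightarrow> taut_domain D \<and>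
     (\<forall>z\<in>D. \<forall>w\<in>D. caratheodory_dist D z w = lempert_fun D z w)"

definition F_ab :: "real \<Rightarrow> real \<Rightarrow> complex ^ 2 \<Rightarrow> complex" where
  "F_ab a b z =
     (of_real a * z $ 1 + of_real b * z $ 2 - z $ 1 * z $ 2) /
     (of_real a * z $ 2 + of_real b * z $ 1 - 1)"

text \<open>
  The nonvanishing of the denominator has to be stated: since \<open>x / 0 = 0\<close>, the
  inequality \<open>cmod (F_ab a b z) < 1\<close> alone would admit the poles of \<open>F_ab a b\<close>.
\<close>

definition D_ab :: "real \<Rightarrow> real \<Rightarrow> (complex ^ 2) set" where
  "D_ab a b =
     {z. z $ 1 \<in> unit_disc \<and> z $ 2 \<in> unit_disc \<and>
         of_real a * z $ 2 + of_real b * z $ 1 - 1 \<noteq> 0 \<and> cmod (F_ab a b z) < 1}"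

lemma D_ab_iff:
  "z \<in> D_ab a b \<longleftrightarrow> z $ 1 \<in> unit_disc \<and> z $ 2 \<in> unit_disc \<and>
     cmod (of_real a * z $ 1 + of_real b * z $ 2 - z $ 1 * z $ 2)
       < cmod (of_real b * z $ 1 + of_real a * z $ 2 - 1)"
proof -
  define N where "N = of_real a * z $ 1 + of_real b * z $ 2 - z $ 1 * z $ 2"
  define Q where "Q = of_real a * z $ 2 + of_real b * z $ 1 - 1"
  have Q: "of_real b * z $ 1 + of_real a * z $ 2 - 1 = Q"
    by (simp add: Q_def)
  have "Q \<noteq> 0 \<and> cmod (N / Q) < 1 \<longleftrightarrow> cmod N < cmod Q"
    by (cases "Q = 0") (simp_all add: norm_divide divide_less_eq)
  then show ?thesis
    unfolding D_ab_def F_ab_def Q mem_Collect_eq N_def[symmetric] Q_def[symmetric] by blast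
qed

end

theory Submission
  imports Defs
begin

text \<open>
  Let \<open>p\<close> and \<open>q\<close> be the unimodular numbers whose arguments are the angles opposite \<open>a\<close> and \<open>b\<close>
  in a triangle with sides \<open>a\<close>, \<open>b\<close>, \<open>1\<close>. Moebius maps of the disc onto the upper half-plane \<open>H\<close> determined by
  \<open>p\<close> and \<open>q\<close> carry \<open>D_ab a b\<close> onto the set of \<open>(x1, x2)\<close> in \<open>H \<times> H\<close> such that
  \<open>x3 = -1 / (x1 * x2)\<close> lies in \<open>H\<close>, which is symmetric in \<open>x1\<close>, \<open>x2\<close>, \<open>x3\<close> and in logarithmic
  coordinates is a tube over a triangle. The Caratheodory distance dominates the hyperbolic distances
  of the three coordinates. Conversely two points are joined by a disc on which the coordinate
  with the largest distance is an automorphism \<open>\<lambda>\<close> of \<open>H\<close>: if a second coordinate is at the same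
  distance it is a real Moebius function of \<open>\<lambda>\<close>, and the general case interpolates two such discs
  in logarithmic coordinates. Tautness follows from Montel's theorem for the three bounded
  coordinates.
\<close>

section \<open>Hyperbolic distance in the upper half-plane\<close>

text \<open>For points of the upper half-plane at hyperbolic distance \<open>d\<close>, in the
  normalization of \<open>rho\<close>, this is four times the square of \<open>sinh d\<close>: a
  rational function of the coordinates that increases with \<open>d\<close>.\<close>

definition hdist :: "complex \<Rightarrow> complex \<Rightarrow> real" where
  "hdist x y = (cmod (x - y))\<^sup>2 / (Im x * Im y)"

lemma hdist_commute: "hdist x y = hdist y x"
  by (simp add: hdist_def norm_minus_commute mult.commute)

lemma cmod_diff_cnj_power2: "(cmod (x - cnj y))\<^sup>2 = (cmod (x - y))\<^sup>2 + 4 * Im x * Im y"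
  by (simp only: cmod_power2) (simp add: power2_eq_square algebra_simps)

lemma Im_pos_nonzero: "0 < Im x \<Longrightarrow> x \<noteq> 0"
  by auto

lemma Im_pos_diff_cnj_nonzero:
  assumes "0 < Im x" "0 < Im y"
  shows "x - cnj y \<noteq> 0"
  using assms by (auto simp: complex_eq_iff)

text \<open>The squared pseudo-hyperbolic distance equals \<open>1 - 4 / (h + 4)\<close> with
  \<open>h\<close> the value of \<open>hdist\<close>, and this is increasing in
  \<open>h\<close>.\<close>

lemma hdist_le_iff:
  assumes "0 < Im x" "0 < Im y" "0 < Im x'" "0 < Im y'"
  shows "hdist x y \<le> hdist x' y' \<longleftrightarrow>
    cmod ((x - y) / (x - cnj y)) \<le> cmod ((x' - y') / (x' - cnj y'))"
proof -
  have key: "(cmod ((v - w) / (v - cnj w)))\<^sup>2 = 1 - 4 / (hdist v w + 4)"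
    if "0 < Im v" "0 < Im w" for v w
  proof -
    have "Im v * Im w > 0" using that by simp
    then have "4 * (Im v * Im w) + (cmod (v - w))\<^sup>2 > 0"
      by (simp add: add_pos_nonneg)
    with that show ?thesis
      unfolding norm_divide power_divide cmod_diff_cnj_power2 hdist_def
      by (auto simp: divide_simps algebra_simps)
  qed
  have nn: "0 \<le> hdist v w" if "0 < Im v" "0 < Im w" for v w
    using that by (simp add: hdist_def)
  have "cmod ((x - y) / (x - cnj y)) \<le> cmod ((x' - y') / (x' - cnj y'))
     \<longleftrightarrow> (cmod ((x - y) / (x - cnj y)))\<^sup>2 \<le> (cmod ((x' - y') / (x' - cnj y')))\<^sup>2"
    by (meson norm_ge_zero power2_le_imp_le power_mono)
  also have "\<dots> \<longleftrightarrow> hdist x y \<le> hdist x' y'"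
    using nn[OF assms(1,2)] nn[OF assms(3,4)]
    by (simp only: key[OF assms(1,2)] key[OF assms(3,4)]) (simp add: divide_simps algebra_simps)
  finally show ?thesis ..
qed

lemma Im_divide_cnj: "Im (z / w) = Im (z * cnj w) / (cmod w)\<^sup>2"
  by (simp add: Im_divide cmod_power2 algebra_simps)

lemma Im_minus_inverse: "Im (- 1 / x) = Im x / (cmod x)\<^sup>2"
  by (simp add: Im_divide cmod_power2)

lemma Im_minus_inverse_pos: "0 < Im x \<Longrightarrow> 0 < Im (- 1 / x)"
  unfolding Im_minus_inverse by (auto intro!: divide_pos_pos)

lemma hdist_minus_inverse:
  assumes "0 < Im x" "0 < Im y"
  shows "hdist (- 1 / x) (- 1 / y) = hdist x y"
proof -
  have nz: "x \<noteq> 0" "y \<noteq> 0" using assms by auto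
  then have "- 1 / x - - 1 / y = (x - y) / (x * y)" by (simp add: field_simps)
  then have "hdist (- 1 / x) (- 1 / y)
      = (cmod (x - y))\<^sup>2 / (cmod x * cmod y)\<^sup>2 / (Im x / (cmod x)\<^sup>2 * (Im y / (cmod y)\<^sup>2))"
    by (simp only: hdist_def Im_minus_inverse) (simp add: norm_divide norm_mult power_divide)
  also have "\<dots> = hdist x y"
    using nz assms by (simp add: hdist_def power_mult_distrib field_simps)
  finally show ?thesis .
qed

section \<open>Real Moebius maps through two prescribed points\<close>

lemma real_moebius_Im:
  fixes A B C D :: real
  shows "Im ((of_real A * l + of_real B) / (of_real C * l + of_real D))
    = (A * D - B * C) * Im l / (cmod (of_real C * l + of_real D))\<^sup>2"
  by (simp add: Im_divide_cnj) (simp add: algebra_simps)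

lemma real_linear_nonzero:
  fixes C D :: real
  assumes "C \<noteq> 0 \<or> D \<noteq> 0" "0 < Im l"
  shows "of_real C * l + of_real D \<noteq> 0"
  using assms by (auto simp: complex_eq_iff)

text \<open>Two-point homogeneity of the half-plane. The Moebius map is the relation
  \<open>(y - x2) / (y - cnj x2) = K * (l - x1) / (l - cnj x1)\<close>, whose factor
  \<open>K\<close> is unimodular because the two distances agree.\<close>

lemma real_moebius_two_points:
  assumes pos: "0 < Im x1" "0 < Im y1" "0 < Im x2" "0 < Im y2"
    and "x1 \<noteq> y1" and eq: "hdist x1 y1 = hdist x2 y2"
  obtains A B C D :: real where "A * D - B * C > 0"
    "of_real A * x1 + of_real B = x2 * (of_real C * x1 + of_real D)"
    "of_real A * y1 + of_real B = y2 * (of_real C * y1 + of_real D)"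
proof -
  define K where "K = ((y2 - x2) / (y2 - cnj x2)) / ((y1 - x1) / (y1 - cnj x1))"
  have nz: "y1 - cnj x1 \<noteq> 0" "y2 - cnj x2 \<noteq> 0" "y1 - x1 \<noteq> 0"
    using pos \<open>x1 \<noteq> y1\<close> Im_pos_diff_cnj_nonzero by auto
  have "cmod ((y2 - x2) / (y2 - cnj x2)) = cmod ((y1 - x1) / (y1 - cnj x1))"
    using hdist_le_iff[of y1 x1 y2 x2] hdist_le_iff[of y2 x2 y1 x1] pos eq
    by (simp add: hdist_commute)
  then have "cmod K = 1"
    using nz by (simp only: K_def norm_divide[of "(y2 - x2) / (y2 - cnj x2)"]) (simp add: norm_divide)
  \<comment> \<open>A square root of \<open>K\<close> is split evenly over both sides. Since
    \<open>cnj u = u * K\<close>, the relation becomes \<open>u * (x2 - y) * (l - cnj x1) = cnj u *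
    (cnj x2 - y) * (l - x1)\<close>. Corresponding coefficients of the two sides are conjugate, so
    their differences divided by \<open>2 * \<i>\<close> are real; these give \<open>A\<close>,
    \<open>B\<close>, \<open>C\<close>, \<open>D\<close>.\<close>
  define u where "u = cnj (csqrt K)"
  have u1: "u * cnj u = 1"
    using \<open>cmod K = 1\<close> by (simp add: u_def complex_norm_square[symmetric] mult.commute)
  have uK: "cnj u = u * K"
  proof -
    have "cnj u * cnj u = K" by (simp add: u_def power2_eq_square[symmetric])
    then show ?thesis using u1 by (metis mult.assoc mult.left_neutral)
  qed
  define A where "A = Im (u * x2)"
  define B where "B = - Im (u * x2 * cnj x1)"
  define C where "C = Im u"
  define D where "D = - Im (u * cnj x1)"
  have lin: "of_real (Im w) * x + of_real (- Im (w * cnj x)) = w * of_real (Im x)" for w x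
    by (simp add: complex_eq_iff algebra_simps)
  have c1: "of_real A * x1 + of_real B = x2 * (of_real C * x1 + of_real D)"
    using lin[of "u * x2" x1] lin[of u x1] by (simp add: A_def B_def C_def D_def mult_ac)
  have "2 * \<i> * (of_real A * y1 + of_real B - y2 * (of_real C * y1 + of_real D))
      = u * (x2 - y2) * (y1 - cnj x1) - cnj u * (cnj x2 - y2) * (y1 - x1)"
    by (simp add: A_def B_def C_def D_def complex_eq_iff algebra_simps)
  also have "cnj u * (cnj x2 - y2) * (y1 - x1) = - (u * (K * ((y2 - cnj x2) * (y1 - x1))))"
    by (simp add: uK algebra_simps)
  also have "K * ((y2 - cnj x2) * (y1 - x1)) = (y2 - x2) * (y1 - cnj x1)"
    using nz by (simp add: K_def)
  also have "u * (x2 - y2) * (y1 - cnj x1) - - (u * ((y2 - x2) * (y1 - cnj x1))) = 0"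
    by (simp add: algebra_simps)
  finally have c2: "of_real A * y1 + of_real B = y2 * (of_real C * y1 + of_real D)"
    by simp
  have "A * D - B * C = ((Re u)\<^sup>2 + (Im u)\<^sup>2) * (Im x1 * Im x2)"
    by (simp add: A_def B_def C_def D_def power2_eq_square algebra_simps)
  also have "(Re u)\<^sup>2 + (Im u)\<^sup>2 = 1"
    using u1 by (simp add: complex_mult_cnj complex_eq_iff)
  finally have "A * D - B * C > 0" using pos by simp
  from this c1 c2 show thesis by (rule that)
qed

text \<open>
  For a real Moebius map \<open>m\<close> the divided difference of \<open>\<lambda> m(\<lambda>)\<close> is governed by a real
  symmetric bilinear form \<open>N\<close>; contraction at one pair of points forces its determinant
  to be nonnegative, and a semidefinite \<open>N\<close> keeps \<open>\<lambda> m(\<lambda>)\<close> in the half-plane everywhere.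
\<close>

lemma moebius_times_id_stays_in_half_plane:
  assumes pos: "0 < Im x1" "0 < Im y1" "0 < Im x2" "0 < Im y2"
    and "x1 \<noteq> y1" and eq: "hdist x1 y1 = hdist x2 y2"
    and pr: "0 < Im (x1 * x2)" "0 < Im (y1 * y2)"
    and le: "hdist (x1 * x2) (y1 * y2) \<le> hdist x1 y1"
  obtains m where "m holomorphic_on {l. 0 < Im l}" "m x1 = x2" "m y1 = y2"
    "\<And>l. 0 < Im l \<Longrightarrow> 0 < Im (m l)" "\<And>l. 0 < Im l \<Longrightarrow> 0 < Im (l * m l)"
proof -
  obtain A B C D :: real where det: "A * D - B * C > 0"
    and c1: "of_real A * x1 + of_real B = x2 * (of_real C * x1 + of_real D)"
    and c2: "of_real A * y1 + of_real B = y2 * (of_real C * y1 + of_real D)"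
    by (rule real_moebius_two_points[OF pos \<open>x1 \<noteq> y1\<close> eq])
  define q where "q l = of_real C * l + of_real D" for l :: complex
  define m where "m l = (of_real A * l + of_real B) / q l" for l
  \<comment> \<open>\<open>N\<close> is the bilinear form of the divided difference of
    \<open>l * m l\<close>. Its diagonal \<open>M x\<close> is \<open>N x (cnj x)\<close> and
    carries the sign of the imaginary part of \<open>x * m x\<close>.\<close>
  define N where "N x y = of_real (A * C) * x * y + of_real (A * D) * (x + y) + of_real (B * D)"
    for x y :: complex
  define M where "M x = A * C * (cmod x)\<^sup>2 + 2 * (A * D) * Re x + B * D" for x
  have CD: "C \<noteq> 0 \<or> D \<noteq> 0" using det by auto
  have q: "q l \<noteq> 0" if "0 < Im l" for l
    unfolding q_def by (rule real_linear_nonzero[OF CD that])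
  have mx: "m x1 = x2" and my: "m y1 = y2"
    using c1 c2 q[OF pos(1)] q[OF pos(2)] by (simp_all add: m_def q_def)
  have Im_m: "0 < Im (m l)" if "0 < Im l" for l
    using that det q[OF that] by (simp add: m_def q_def real_moebius_Im)
  have Im_lm: "Im (l * m l) = Im l * M l / (cmod (q l))\<^sup>2" if "0 < Im l" for l
  proof -
    have "Im (l * m l) = Im (l * (of_real A * l + of_real B) * cnj (q l)) / (cmod (q l))\<^sup>2"
      unfolding m_def times_divide_eq_right by (rule Im_divide_cnj)
    also have "Im (l * (of_real A * l + of_real B) * cnj (q l)) = Im l * M l"
      unfolding M_def cmod_power2 q_def by (simp add: power2_eq_square algebra_simps)
    finally show ?thesis .
  qed
  have diff: "l * m l - k * m k = (l - k) * N l k / (q l * q k)" if "0 < Im l" "0 < Im k" for l k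
    using q[OF that(1)] q[OF that(2)] unfolding m_def
    by (simp add: divide_simps) (simp add: N_def q_def algebra_simps)
  have Mpos: "0 < M x1" "0 < M y1"
    using pr Im_lm[OF pos(1)] Im_lm[OF pos(2)] pos q
    by (auto simp: mx my zero_less_mult_iff zero_less_divide_iff)
  have "(cmod (x1 - y1))\<^sup>2 * (cmod (N x1 y1))\<^sup>2 / (Im x1 * M x1 * (Im y1 * M y1))
      = (cmod ((x1 - y1) * N x1 y1 / (q x1 * q y1)))\<^sup>2
        / (Im x1 * M x1 / (cmod (q x1))\<^sup>2 * (Im y1 * M y1 / (cmod (q y1))\<^sup>2))"
    using q[OF pos(1)] q[OF pos(2)] by (simp add: norm_divide norm_mult power_divide power_mult_distrib)
  also have "\<dots> = hdist (x1 * x2) (y1 * y2)"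
    using diff[OF pos(1,2)] Im_lm[OF pos(1)] Im_lm[OF pos(2)] by (simp only: hdist_def mx my)
  also have "\<dots> \<le> (cmod (x1 - y1))\<^sup>2 / (Im x1 * Im y1)"
    using le by (simp add: hdist_def)
  finally have "(cmod (N x1 y1))\<^sup>2 \<le> M x1 * M y1"
    using pos Mpos \<open>x1 \<noteq> y1\<close> by (simp add: divide_simps mult_ac)
  \<comment> \<open>The factor \<open>A * D * (A * D - B * C)\<close> is minus the determinant of
    \<open>N\<close>, so the contraction hypothesis fixes its sign.\<close>
  moreover have "(cmod (N x1 y1))\<^sup>2 - M x1 * M y1
      = A * D * (A * D - B * C) * (cmod (x1 - cnj y1))\<^sup>2"
    unfolding N_def M_def cmod_power2 by (simp add: power2_eq_square algebra_simps)
  ultimately have "A * D * (A * D - B * C) * (cmod (x1 - cnj y1))\<^sup>2 \<le> 0" by simp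
  then have AD: "A * D \<le> 0"
    using det Im_pos_diff_cnj_nonzero[OF pos(1,2)]
    by (simp add: mult_le_0_iff zero_le_mult_iff not_less)
  have disc: "(A * D)\<^sup>2 \<le> (A * C) * (B * D)"
  proof -
    have "0 \<le> (- (A * D)) * (A * D - B * C)" using AD det by (intro mult_nonneg_nonneg) auto
    then show ?thesis by (simp add: power2_eq_square algebra_simps)
  qed
  have sq: "(A * C) * M l = (A * C * Re l + A * D)\<^sup>2 + (A * C * Im l)\<^sup>2
      + ((A * C) * (B * D) - (A * D)\<^sup>2)" for l
    unfolding M_def cmod_power2 by (simp add: power2_eq_square algebra_simps)
  \<comment> \<open>If \<open>A * C = 0\<close>, then \<open>disc\<close> also kills
    \<open>A * D\<close> and \<open>M\<close> is a constant, positive by its value at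
    \<open>x1\<close>. Otherwise completing the square shows that \<open>M\<close> never vanishes on
    the half-plane and always has the sign of \<open>A * C\<close>, which is again read off at
    \<open>x1\<close>.\<close>
  have M_all: "0 < M l" if "0 < Im l" for l
  proof (cases "A * C = 0")
    case True
    then have "(A * D)\<^sup>2 \<le> 0" using disc by (simp only: mult_zero_left)
    then have "A * D = 0" by simp
    with True Mpos(1) show ?thesis by (simp only: M_def)
  next
    case False
    have gt: "0 < (A * C) * M k" if "0 < Im k" for k
    proof -
      have "0 < (A * C * Im k)\<^sup>2" using False that by simp
      then show ?thesis unfolding sq using disc by (simp add: add_nonneg_pos add_pos_nonneg)
    qed
    have "0 < A * C"
      using gt[OF pos(1)] Mpos(1) by (simp add: zero_less_mult_iff)
    then show ?thesis using gt[OF that] by (metis zero_less_mult_pos)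
  qed
  have "m holomorphic_on {l. 0 < Im l}"
    unfolding m_def using q by (auto intro!: holomorphic_intros simp: q_def)
  moreover have "0 < Im (l * m l)" if "0 < Im l" for l
    using Im_lm[OF that] M_all[OF that] that q[OF that] by simp
  ultimately show thesis using mx my Im_m that by blast
qed

section \<open>Extremal maps and their logarithmic interpolation\<close>

lemma hdist_scale: "0 < r \<Longrightarrow> hdist (of_real r * x) (of_real r * y) = hdist x y"
  by (simp add: hdist_def norm_mult power_mult_distrib flip: right_diff_distrib)
     (simp add: power2_eq_square)

lemma Im_times_of_real: "Im (of_real r * z) = r * Im z"
  by simp

text \<open>Scaling one point by a large factor makes its distance from a fixed point unbounded, so
  the intermediate value theorem gives a scaling at which the larger of the two distances is exactly
  \<open>R\<close>. This reduces the general case to one in which a second coordinate is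
  extremal.\<close>

lemma hdist_scaling_reaches:
  assumes "0 < Im x" "0 < Im y" "0 < Im p" "0 < Im q"
    and le: "max (hdist x y) (hdist p q) \<le> R"
  obtains s where "0 \<le> s" "max (hdist x (of_real (exp s) * y)) (hdist p (of_real (exp s) * q)) = R"
proof -
  define f where "f s = max (hdist x (of_real (exp s) * y)) (hdist p (of_real (exp s) * q))" for s
  have "y \<noteq> 0" "0 < cmod y" using assms(2) by auto
  \<comment> \<open>\<open>K\<close> comes from the bound
    \<open>K * (K * (cmod y)\<^sup>2 - 2 * cmod x * cmod y)\<close> for the square of
    \<open>cmod (x - of_real K * y)\<close>. The lower bound 1 on \<open>K\<close> keeps
    \<open>ln K\<close> nonnegative.\<close>
  define K where "K = max 1 ((R * (Im x * Im y) + 2 * cmod x * cmod y) / (cmod y)\<^sup>2)"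
  have "1 \<le> K" and "(R * (Im x * Im y) + 2 * cmod x * cmod y) / (cmod y)\<^sup>2 \<le> K"
    by (simp_all add: K_def)
  then have K: "R * (Im x * Im y) + 2 * cmod x * cmod y \<le> K * (cmod y)\<^sup>2"
    using \<open>0 < cmod y\<close> by (simp add: pos_divide_le_eq)
  have "R \<le> hdist x (of_real K * y)"
  proof -
    have "K * (R * (Im x * Im y)) \<le> K * (K * (cmod y)\<^sup>2 - 2 * cmod x * cmod y)"
      using \<open>1 \<le> K\<close> K by (intro mult_left_mono) auto
    also have "\<dots> \<le> (K * cmod y - cmod x)\<^sup>2"
      by (simp add: power2_eq_square algebra_simps)
    also have "\<dots> \<le> (cmod (x - of_real K * y))\<^sup>2"
    proof -
      have "\<bar>K * cmod y - cmod x\<bar> \<le> cmod (x - of_real K * y)"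
        using norm_triangle_ineq3[of "of_real K * y" x] \<open>1 \<le> K\<close>
        by (simp add: norm_mult norm_minus_commute)
      then show ?thesis by (simp add: abs_le_square_iff[symmetric])
    qed
    finally show ?thesis
      using assms(1,2) \<open>1 \<le> K\<close> by (simp add: hdist_def pos_le_divide_eq mult_ac)
  qed
  then have "R \<le> f (ln K)" using \<open>1 \<le> K\<close> by (simp add: f_def)
  moreover have "f 0 \<le> R" using le by (simp add: f_def)
  moreover have "continuous_on {0..ln K} f"
    unfolding f_def hdist_def using assms(1-4) by (intro continuous_intros) auto
  ultimately obtain s where "0 \<le> s" "f s = R"
    using IVT'[of f 0 R "ln K"] \<open>1 \<le> K\<close> by auto
  then show thesis using that by (simp add: f_def)
qed

text \<open>Either the second or the third coordinate has the same distance as the first. In the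
  first case the real Moebius map serves as \<open>m\<close>. In the second case it is applied to
  the third coordinate \<open>- 1 / (x1 * x2)\<close>, and the second coordinate is recovered from
  the product relation.\<close>

lemma extremal_half_plane_map:
  assumes pos: "0 < Im x1" "0 < Im y1" "0 < Im x2" "0 < Im y2"
    and "x1 \<noteq> y1" and pr: "0 < Im (x1 * x2)" "0 < Im (y1 * y2)"
    and eq: "max (hdist x2 y2) (hdist (x1 * x2) (y1 * y2)) = hdist x1 y1"
  obtains m where "m holomorphic_on {l. 0 < Im l}" "m x1 = x2" "m y1 = y2"
    "\<And>l. 0 < Im l \<Longrightarrow> 0 < Im (m l)" "\<And>l. 0 < Im l \<Longrightarrow> 0 < Im (l * m l)"
proof (cases "hdist x2 y2 = hdist x1 y1")
  case True
  then show thesis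
    using moebius_times_id_stays_in_half_plane[OF pos \<open>x1 \<noteq> y1\<close> True[symmetric] pr] eq that
    by (metis max.cobounded2)
next
  case False
  with eq have eq': "hdist (x1 * x2) (y1 * y2) = hdist x1 y1" and le: "hdist x2 y2 \<le> hdist x1 y1"
    by (auto simp: max_def split: if_splits)
  define x3 where "x3 = - 1 / (x1 * x2)"
  define y3 where "y3 = - 1 / (y1 * y2)"
  have nz: "x1 \<noteq> 0" "y1 \<noteq> 0" "x2 \<noteq> 0" "y2 \<noteq> 0" using pos by auto
  have x13: "x1 * x3 = - 1 / x2" and y13: "y1 * y3 = - 1 / y2"
    using nz by (simp_all add: x3_def y3_def)
  have pos3: "0 < Im x3" "0 < Im y3"
    using pr unfolding x3_def y3_def by (simp_all only: Im_minus_inverse_pos)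
  have pr3: "0 < Im (x1 * x3)" "0 < Im (y1 * y3)"
    using pos by (simp_all only: x13 y13 Im_minus_inverse_pos)
  have d3: "hdist x1 y1 = hdist x3 y3"
    using eq' hdist_minus_inverse[OF pr] by (simp add: x3_def y3_def)
  have le3: "hdist (x1 * x3) (y1 * y3) \<le> hdist x1 y1"
    unfolding x13 y13 hdist_minus_inverse[OF pos(3,4)] by (rule le)
  obtain m where m: "m holomorphic_on {l. 0 < Im l}" "m x1 = x3" "m y1 = y3"
    "\<And>l. 0 < Im l \<Longrightarrow> 0 < Im (m l)" "\<And>l. 0 < Im l \<Longrightarrow> 0 < Im (l * m l)"
    by (rule moebius_times_id_stays_in_half_plane[OF pos(1,2) pos3 \<open>x1 \<noteq> y1\<close> d3 pr3 le3]) blast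
  have m0: "m l \<noteq> 0" "l * m l \<noteq> 0" if "0 < Im l" for l
    using m(4)[OF that] m(5)[OF that] by auto
  show thesis
  proof (rule that[of "\<lambda>l. - 1 / (l * m l)"])
    show "(\<lambda>l. - 1 / (l * m l)) holomorphic_on {l. 0 < Im l}"
      using m(1) m0(2) by (intro holomorphic_intros) auto
    show "- 1 / (x1 * m x1) = x2" "- 1 / (y1 * m y1) = y2"
      using x13 y13 nz by (simp_all add: m(2,3))
    show "0 < Im (- 1 / (l * m l))" if "0 < Im l" for l
      by (rule Im_minus_inverse_pos[OF m(5)[OF that]])
    show "0 < Im (l * (- 1 / (l * m l)))" if "0 < Im l" for l
    proof -
      have "l * (- 1 / (l * m l)) = - 1 / m l"
        using that m0[OF that] by simp
      then show ?thesis
        using m(4)[OF that] by (simp only: Im_minus_inverse_pos)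
    qed
  qed
qed

text \<open>This makes the condition on the product an affine inequality in logarithmic coordinates.
  The two arguments add up to less than \<open>2 * pi\<close>, and a sum in the interval from
  \<open>pi\<close> to \<open>2 * pi\<close> would have nonpositive sine.\<close>

lemma Im_Ln_add_less_pi:
  assumes "0 < Im x" "0 < Im y" "0 < Im (x * y)"
  shows "Im (Ln x) + Im (Ln y) < pi"
proof (rule ccontr)
  assume "\<not> ?thesis"
  moreover have "Im (Ln x) + Im (Ln y) < 2 * pi"
    using Im_Ln_pos_lt_imp[OF assms(1)] Im_Ln_pos_lt_imp[OF assms(2)] by simp
  ultimately have "sin (Im (Ln x) + Im (Ln y)) \<le> 0"
    using sin_ge_zero[of "Im (Ln x) + Im (Ln y) - pi"] by (simp add: sin_diff)
  moreover have "x \<noteq> 0" "y \<noteq> 0" using assms(1,2) by auto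
  then have "x * y = exp (Ln x + Ln y)"
    by (simp add: exp_add)
  ultimately have "Im (x * y) \<le> 0"
    by (simp add: Im_exp mult_le_0_iff del: times_complex.sel)
  with assms(3) show False by simp
qed

lemma Ln_exp_times: "y \<noteq> 0 \<Longrightarrow> Ln (of_real (exp s) * y) = of_real s + Ln y"
  by (subst Ln_times_of_real) (simp_all del: of_real_exp add: Ln_of_real exp_of_real)

text \<open>
  In logarithmic coordinates the triples with product \<open>-1\<close> form a tube over a triangle, so maps
  that agree at \<open>x1\<close> and differ by a positive factor at \<open>y1\<close> can be interpolated.
\<close>

lemma half_plane_map_through_two_points:
  assumes pos: "0 < Im x1" "0 < Im y1" "0 < Im x2" "0 < Im y2"
    and "x1 \<noteq> y1" and pr: "0 < Im (x1 * x2)" "0 < Im (y1 * y2)"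
    and le: "hdist x2 y2 \<le> hdist x1 y1" "hdist (x1 * x2) (y1 * y2) \<le> hdist x1 y1"
  obtains m where "m holomorphic_on {l. 0 < Im l}" "m x1 = x2" "m y1 = y2"
    "\<And>l. 0 < Im l \<Longrightarrow> 0 < Im (m l)" "\<And>l. 0 < Im l \<Longrightarrow> 0 < Im (l * m l)"
proof -
  \<comment> \<open>Multiplying \<open>y2\<close> by \<open>exp s\<close> multiplies
    \<open>y1 * y2\<close> by the same factor, so the extremal case applies once the larger of the
    two distances equals \<open>hdist x1 y1\<close>.\<close>
  have endpoint: "\<exists>m. m holomorphic_on {l. 0 < Im l} \<and> m x1 = x2 \<and> m y1 = of_real (exp s) * y2
      \<and> (\<forall>l. 0 < Im l \<longrightarrow> 0 < Im (m l) \<and> 0 < Im (l * m l))"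
    if "max (hdist x2 (of_real (exp s) * y2)) (hdist (x1 * x2) (of_real (exp s) * (y1 * y2))) = hdist x1 y1"
    for s
  proof (rule extremal_half_plane_map[OF pos(1-3) _ \<open>x1 \<noteq> y1\<close> pr(1), of "of_real (exp s) * y2"])
    have ac: "y1 * (of_real (exp s) * y2) = of_real (exp s) * (y1 * y2)" by simp
    show "0 < Im (of_real (exp s) * y2)" using pos by simp
    show "0 < Im (y1 * (of_real (exp s) * y2))"
      unfolding ac using pr(2) by (simp only: Im_times_of_real) simp
    show "max (hdist x2 (of_real (exp s) * y2)) (hdist (x1 * x2) (y1 * (of_real (exp s) * y2)))
        = hdist x1 y1" unfolding ac by (rule that)
  qed blast
  obtain s where s: "0 \<le> s"
    "max (hdist x2 (of_real (exp s) * y2)) (hdist (x1 * x2) (of_real (exp s) * (y1 * y2))) = hdist x1 y1"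
    by (rule hdist_scaling_reaches[OF pos(3,4) pr]) (use le in auto)
  \<comment> \<open>For the opposite direction \<open>x2\<close> is scaled up instead; by scale
    invariance this is the same as scaling \<open>y2\<close> down by \<open>exp (- s')\<close>, as
    \<open>swap\<close> records.\<close>
  obtain s' where s': "0 \<le> s'"
    "max (hdist y2 (of_real (exp s') * x2)) (hdist (y1 * y2) (of_real (exp s') * (x1 * x2))) = hdist x1 y1"
    by (rule hdist_scaling_reaches[OF pos(4,3) pr(2,1)]) (use le in \<open>auto simp: hdist_commute\<close>)
  have swap: "hdist x (of_real (exp (- s')) * y) = hdist y (of_real (exp s') * x)" for x y
    using hdist_scale[of "exp s'" x "of_real (exp (- s')) * y"]
    by (simp add: hdist_commute exp_minus flip: mult.assoc of_real_mult)
  obtain g where g: "g holomorphic_on {l. 0 < Im l}" "g x1 = x2" "g y1 = of_real (exp s) * y2"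
    "\<And>l. 0 < Im l \<Longrightarrow> 0 < Im (g l)" "\<And>l. 0 < Im l \<Longrightarrow> 0 < Im (l * g l)"
    using endpoint[OF s(2)] by blast
  obtain h where h: "h holomorphic_on {l. 0 < Im l}" "h x1 = x2" "h y1 = of_real (exp (- s')) * y2"
    "\<And>l. 0 < Im l \<Longrightarrow> 0 < Im (h l)" "\<And>l. 0 < Im l \<Longrightarrow> 0 < Im (l * h l)"
    using endpoint[of "- s'"] s'(2) unfolding swap by blast
  \<comment> \<open>The weight is chosen so that the logarithmic shifts \<open>s\<close> and
    \<open>- s'\<close> at \<open>y1\<close> cancel. If \<open>s + s' = 0\<close>, both shifts are
    zero and any weight works.\<close>
  obtain t where t: "0 \<le> t" "t \<le> 1" "t * s = (1 - t) * s'"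
  proof (cases "s + s' = 0")
    case True
    then show ?thesis using that[of 0] s(1) s'(1) by simp
  next
    case False
    then show ?thesis
      using that[of "s' / (s + s')"] s(1) s'(1) by (simp add: field_simps)
  qed
  \<comment> \<open>All constraints on \<open>k\<close> are strict affine inequalities between
    imaginary parts, so the convex combination inherits them from the logarithms of \<open>g\<close>
    and \<open>h\<close>.\<close>
  define k where "k l = of_real t * Ln (g l) + of_real (1 - t) * Ln (h l)" for l
  have Im_k: "Im (k l) = t * Im (Ln (g l)) + (1 - t) * Im (Ln (h l))" for l
    by (simp add: k_def)
  have less: "t * u + (1 - t) * v < w" if "u < w" "v < w" for u v w :: real
    using convex_bound_lt[of u w v t "1 - t"] that t by simp
  have gt: "w < t * u + (1 - t) * v" if "w < u" "w < v" for u v w :: real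
    using less[of "- u" "- w" "- v"] that by simp
  have k_pos: "0 < Im (k l)" if "0 < Im l" for l
    unfolding Im_k
    using Im_Ln_pos_lt_imp[OF g(4)[OF that]] Im_Ln_pos_lt_imp[OF h(4)[OF that]] by (intro gt) auto
  have k_less: "Im (Ln l) + Im (k l) < pi" if "0 < Im l" for l
    using less[of "Im (Ln (g l))" "pi - Im (Ln l)" "Im (Ln (h l))"]
      Im_Ln_add_less_pi[OF that g(4)[OF that] g(5)[OF that]]
      Im_Ln_add_less_pi[OF that h(4)[OF that] h(5)[OF that]]
    by (simp add: Im_k)
  have Im_exp_pos: "0 < Im (exp v)" if "0 < Im v" "Im v < pi" for v
    using that by (simp add: Im_exp sin_gt_zero)
  show thesis
  proof (rule that[of "\<lambda>l. exp (k l)"])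
    have "g l \<notin> \<real>\<^sub>\<le>\<^sub>0" "h l \<notin> \<real>\<^sub>\<le>\<^sub>0" if "0 < Im l" for l
      using g(4)[OF that] h(4)[OF that] by (auto simp: complex_nonpos_Reals_iff)
    then show "(\<lambda>l. exp (k l)) holomorphic_on {l. 0 < Im l}"
      unfolding k_def using g(1) h(1) by (intro holomorphic_intros) auto
    have "k x1 = Ln x2" by (simp add: k_def g(2) h(2) flip: distrib_right of_real_add)
    moreover have "x2 \<noteq> 0" using pos by auto
    ultimately show "exp (k x1) = x2" by simp
    have "y2 \<noteq> 0" using pos by auto
    have L: "Ln (g y1) = of_real s + Ln y2" "Ln (h y1) = of_real (- s') + Ln y2"
      unfolding g(3) h(3) by (rule Ln_exp_times[OF \<open>y2 \<noteq> 0\<close>])+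
    have "k y1 = of_real (t * s - (1 - t) * s') + Ln y2"
      unfolding k_def L by (simp add: algebra_simps)
    then show "exp (k y1) = y2" using t(3) \<open>y2 \<noteq> 0\<close> by simp
    show "0 < Im (exp (k l))" if "0 < Im l" for l
      using k_pos[OF that] k_less[OF that] Im_Ln_pos_lt_imp[OF that] by (intro Im_exp_pos) auto
    show "0 < Im (l * exp (k l))" if "0 < Im l" for l
    proof -
      have "l * exp (k l) = exp (Ln l + k l)"
        using Im_pos_nonzero[OF that] by (simp add: exp_add)
      then show ?thesis
        using k_pos[OF that] k_less[OF that] Im_Ln_pos_lt_imp[OF that]
        by (simp only:) (intro Im_exp_pos; simp)
    qed
  qed
qed

section \<open>Analytic discs through two triples with product -1\<close>

lemma eq_minus_inverse:
  fixes u w :: complex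
  assumes "u * w = -1"
  shows "u = - 1 / w"
  using assms by (metis mult_zero_right nonzero_eq_divide_eq zero_neq_neg_one)

text \<open>The first coordinate, having the largest distance, is made a biholomorphic map of the
  disc onto the half-plane, which forces the value of \<open>cmod t\<close>. The other two
  coordinates are \<open>m\<close> of the first and the factor completing the product to -1.\<close>

lemma disc_through_two_triples_aux:
  assumes pos: "0 < Im x1" "0 < Im x2" "0 < Im x3" "0 < Im y1" "0 < Im y2" "0 < Im y3"
    and prod: "x1 * x2 * x3 = -1" "y1 * y2 * y3 = -1"
    and ne: "x1 \<noteq> y1" and le: "hdist x2 y2 \<le> hdist x1 y1" "hdist x3 y3 \<le> hdist x1 y1"
  obtains t g1 g2 g3 where "cmod t < 1" "cmod t = cmod ((x1 - y1) / (x1 - cnj y1))"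
    "g1 holomorphic_on unit_disc" "g2 holomorphic_on unit_disc" "g3 holomorphic_on unit_disc"
    "g1 0 = x1" "g2 0 = x2" "g3 0 = x3" "g1 t = y1" "g2 t = y2" "g3 t = y3"
    "\<And>u. cmod u < 1 \<Longrightarrow> 0 < Im (g1 u)" "\<And>u. cmod u < 1 \<Longrightarrow> 0 < Im (g2 u)"
    "\<And>u. cmod u < 1 \<Longrightarrow> 0 < Im (g3 u)" "\<And>u. cmod u < 1 \<Longrightarrow> g1 u * g2 u * g3 u = -1"
proof -
  have nz: "x1 \<noteq> 0" "x2 \<noteq> 0" "x3 \<noteq> 0" "y1 \<noteq> 0" "y2 \<noteq> 0" "y3 \<noteq> 0" using pos by auto
  have x12: "x1 * x2 = - 1 / x3" and y12: "y1 * y2 = - 1 / y3"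
    using prod by (simp_all only: eq_minus_inverse)
  have x3: "x3 = - 1 / (x1 * x2)" and y3: "y3 = - 1 / (y1 * y2)"
    unfolding x12 y12 using nz by auto
  have pr: "0 < Im (x1 * x2)" "0 < Im (y1 * y2)"
    using pos by (simp_all only: x12 y12 Im_minus_inverse_pos)
  have "hdist (x1 * x2) (y1 * y2) \<le> hdist x1 y1"
    unfolding x12 y12 hdist_minus_inverse[OF pos(3,6)] by (rule le(2))
  from half_plane_map_through_two_points[OF pos(1,4,2,5) ne pr le(1) this]
  obtain m where m: "m holomorphic_on {l. 0 < Im l}" "m x1 = x2" "m y1 = y2"
    "\<And>l. 0 < Im l \<Longrightarrow> 0 < Im (m l)" "\<And>l. 0 < Im l \<Longrightarrow> 0 < Im (l * m l)" by blast
  \<comment> \<open>\<open>c\<close> is the Cayley map sending 0 to \<open>x1\<close>, and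
    \<open>t\<close> is the preimage of \<open>y1\<close> under it.\<close>
  define c where "c u = (x1 - cnj x1 * u) / (1 - u)" for u
  define t where "t = (y1 - x1) / (y1 - cnj x1)"
  have d: "y1 - cnj x1 \<noteq> 0" "cnj x1 - x1 \<noteq> 0"
    using pos by (auto simp: complex_eq_iff)
  have "(cmod (y1 - x1))\<^sup>2 < (cmod (y1 - cnj x1))\<^sup>2"
    unfolding cmod_diff_cnj_power2[of y1 x1] using pos by simp
  then have t1: "cmod t < 1"
    using d by (simp add: t_def norm_divide power2_less_imp_less)
  have "cmod (cnj (y1 - cnj x1)) = cmod (x1 - cnj y1)"
    by (simp only: complex_cnj_diff complex_cnj_cnj norm_minus_commute)
  then have t2: "cmod t = cmod ((x1 - y1) / (x1 - cnj y1))"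
    by (simp only: t_def norm_divide complex_mod_cnj norm_minus_commute[of y1 x1])
  have n1: "1 - u \<noteq> 0" if "cmod u < 1" for u
    using that by auto
  have ct: "c t = y1"
  proof -
    have "1 - t = (x1 - cnj x1) / (y1 - cnj x1)" "x1 - cnj x1 * t = y1 * (x1 - cnj x1) / (y1 - cnj x1)"
      using d by (simp_all add: t_def field_simps)
    then show ?thesis using d by (simp add: c_def)
  qed
  have c_pos: "0 < Im (c u)" if "cmod u < 1" for u
  proof -
    have "Im ((x1 - cnj x1 * u) * cnj (1 - u)) = Im x1 * (1 - (cmod u)\<^sup>2)"
      by (simp only: cmod_power2) (simp add: power2_eq_square algebra_simps)
    moreover have "(cmod u)\<^sup>2 < 1" using that by (simp add: abs_square_less_1)
    ultimately show ?thesis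
      unfolding c_def Im_divide_cnj using n1[OF that] pos by simp
  qed
  have c_hol: "c holomorphic_on unit_disc"
    unfolding c_def using n1 by (intro holomorphic_intros) auto
  have mc_hol: "(\<lambda>u. m (c u)) holomorphic_on unit_disc"
    using c_pos by (intro holomorphic_on_compose_gen
          [OF c_hol m(1), unfolded o_def]) auto
  have cm: "0 < Im (c u * m (c u))" if "cmod u < 1" for u
    by (rule m(5)[OF c_pos[OF that]])
  have cm0: "c u * m (c u) \<noteq> 0" if "cmod u < 1" for u
    using Im_pos_nonzero[OF cm[OF that]] .
  show thesis
  proof (rule that[OF t1 t2 c_hol mc_hol, of "\<lambda>u. - 1 / (c u * m (c u))"])
    show "(\<lambda>u. - 1 / (c u * m (c u))) holomorphic_on unit_disc"
      using cm0 by (intro holomorphic_intros c_hol mc_hol) auto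
    show "c 0 = x1" by (simp add: c_def)
    then show "m (c 0) = x2" "- 1 / (c 0 * m (c 0)) = x3"
      by (simp_all only: m(2) x3)
    show "c t = y1" "m (c t) = y2" "- 1 / (c t * m (c t)) = y3"
      by (simp_all only: ct m(3) y3)
    show "0 < Im (c u)" "0 < Im (m (c u))" "0 < Im (- 1 / (c u * m (c u)))" if "cmod u < 1" for u
      using c_pos[OF that] m(4) cm[OF that] by (simp_all only: Im_minus_inverse_pos)
    show "c u * m (c u) * (- 1 / (c u * m (c u))) = - 1" if "cmod u < 1" for u
      using cm0[OF that] by simp
  qed
qed

lemma disc_through_two_triples:
  assumes pos: "0 < Im x1" "0 < Im x2" "0 < Im x3" "0 < Im y1" "0 < Im y2" "0 < Im y3"
    and prod: "x1 * x2 * x3 = -1" "y1 * y2 * y3 = -1"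
    and ne: "x1 \<noteq> y1 \<or> x2 \<noteq> y2"
  obtains t g1 g2 g3 where "cmod t < 1"
    "cmod t = cmod ((x1 - y1) / (x1 - cnj y1)) \<or> cmod t = cmod ((x2 - y2) / (x2 - cnj y2))
      \<or> cmod t = cmod ((x3 - y3) / (x3 - cnj y3))"
    "g1 holomorphic_on unit_disc" "g2 holomorphic_on unit_disc"
    "g1 0 = x1" "g2 0 = x2" "g1 t = y1" "g2 t = y2"
    "\<And>u. cmod u < 1 \<Longrightarrow> 0 < Im (g1 u)" "\<And>u. cmod u < 1 \<Longrightarrow> 0 < Im (g2 u)"
    "\<And>u. cmod u < 1 \<Longrightarrow> 0 < Im (g1 u * g2 u)"
proof -
  have product: "0 < Im (u * v)" if "u * v * w = -1" "0 < Im w" for u v w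
  proof -
    show ?thesis using that(2) by (simp only: eq_minus_inverse[OF that(1)] Im_minus_inverse_pos)
  qed
  have zero: "x = y" if "hdist x y \<le> 0" "0 < Im x" "0 < Im y" for x y
    using that by (auto simp: hdist_def divide_le_0_iff mult_le_0_iff)
  \<comment> \<open>A coordinate of largest distance cannot have equal entries, since then all three
    distances would vanish, against \<open>ne\<close>.\<close>
  consider "x1 \<noteq> y1" "hdist x2 y2 \<le> hdist x1 y1" "hdist x3 y3 \<le> hdist x1 y1"
    | "x2 \<noteq> y2" "hdist x1 y1 \<le> hdist x2 y2" "hdist x3 y3 \<le> hdist x2 y2"
    | "x3 \<noteq> y3" "hdist x1 y1 \<le> hdist x3 y3" "hdist x2 y2 \<le> hdist x3 y3"
  proof -
    have "hdist x x = 0" for x by (simp add: hdist_def)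
    with ne zero[OF _ pos(1,4)] zero[OF _ pos(2,5)] show thesis
      by (metis that linorder_linear order.trans)
  qed
  then show thesis
  proof cases
    case 1
    from disc_through_two_triples_aux[OF pos prod 1]
    obtain t g1 g2 g3 where g: "cmod t < 1" "cmod t = cmod ((x1 - y1) / (x1 - cnj y1))"
      "g1 holomorphic_on unit_disc" "g2 holomorphic_on unit_disc" "g3 holomorphic_on unit_disc"
      "g1 0 = x1" "g2 0 = x2" "g3 0 = x3" "g1 t = y1" "g2 t = y2" "g3 t = y3"
      "\<And>u. cmod u < 1 \<Longrightarrow> 0 < Im (g1 u)" "\<And>u. cmod u < 1 \<Longrightarrow> 0 < Im (g2 u)"
      "\<And>u. cmod u < 1 \<Longrightarrow> 0 < Im (g3 u)" "\<And>u. cmod u < 1 \<Longrightarrow> g1 u * g2 u * g3 u = -1"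
      by metis
    have "0 < Im (g1 u * g2 u)" if "cmod u < 1" for u
      using product[OF g(15)[OF that] g(14)[OF that]] .
    with g show thesis by (intro that[of t g1 g2]) auto
  next
    case 2
    have prod': "x2 * x1 * x3 = -1" "y2 * y1 * y3 = -1" using prod by (simp_all add: mult_ac)
    from disc_through_two_triples_aux[OF pos(2,1,3) pos(5,4,6) prod' 2]
    obtain t g1 g2 g3 where g: "cmod t < 1" "cmod t = cmod ((x2 - y2) / (x2 - cnj y2))"
      "g1 holomorphic_on unit_disc" "g2 holomorphic_on unit_disc" "g3 holomorphic_on unit_disc"
      "g1 0 = x2" "g2 0 = x1" "g3 0 = x3" "g1 t = y2" "g2 t = y1" "g3 t = y3"
      "\<And>u. cmod u < 1 \<Longrightarrow> 0 < Im (g1 u)" "\<And>u. cmod u < 1 \<Longrightarrow> 0 < Im (g2 u)"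
      "\<And>u. cmod u < 1 \<Longrightarrow> 0 < Im (g3 u)" "\<And>u. cmod u < 1 \<Longrightarrow> g1 u * g2 u * g3 u = -1"
      by metis
    have "0 < Im (g2 u * g1 u)" if "cmod u < 1" for u
      using product[OF g(15)[OF that] g(14)[OF that]] by (simp only: mult.commute)
    with g show thesis by (intro that[of t g2 g1]) auto
  next
    case 3
    have prod': "x3 * x1 * x2 = -1" "y3 * y1 * y2 = -1" using prod by (simp_all add: mult_ac)
    from disc_through_two_triples_aux[OF pos(3,1,2) pos(6,4,5) prod' 3]
    obtain t g1 g2 g3 where g: "cmod t < 1" "cmod t = cmod ((x3 - y3) / (x3 - cnj y3))"
      "g1 holomorphic_on unit_disc" "g2 holomorphic_on unit_disc" "g3 holomorphic_on unit_disc"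
      "g1 0 = x3" "g2 0 = x1" "g3 0 = x2" "g1 t = y3" "g2 t = y1" "g3 t = y2"
      "\<And>u. cmod u < 1 \<Longrightarrow> 0 < Im (g1 u)" "\<And>u. cmod u < 1 \<Longrightarrow> 0 < Im (g2 u)"
      "\<And>u. cmod u < 1 \<Longrightarrow> 0 < Im (g3 u)" "\<And>u. cmod u < 1 \<Longrightarrow> g1 u * g2 u * g3 u = -1"
      by metis
    have "0 < Im (g2 u * g3 u)" if "cmod u < 1" for u
      using product[of "g2 u" "g3 u" "g1 u"] g(12,15)[OF that] by (simp only: mult_ac)
    with g show thesis by (intro that[of t g2 g3]) auto
  qed
qed

section \<open>Moebius involutions exchanging disc and half-plane\<close>

text \<open>For unimodular \<open>p\<close> with positive imaginary part this map exchanges the unit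
  disc and the upper half-plane. It sends 0 to \<open>p\<close>, and as an involution it serves in
  both directions.\<close>

definition half_map :: "complex \<Rightarrow> complex \<Rightarrow> complex" where
  "half_map p z = (1 - cnj p * z) / (cnj p - z)"

lemma half_map_denom_nonzero:
  assumes "cmod p = 1" "cmod z < 1"
  shows "cnj p - z \<noteq> 0"
  using assms by (metis complex_mod_cnj eq_iff_diff_eq_0 less_irrefl)

lemma half_map_denom_nonzero_half_plane:
  assumes "0 < Im p" "0 < Im x"
  shows "cnj p - x \<noteq> 0"
  using assms by (auto simp: complex_eq_iff)

lemma cnj_mult_self_eq_1: "cmod p = 1 \<Longrightarrow> cnj p * p = 1"
  by (metis complex_norm_square mult.commute of_real_1 one_power2)

text \<open>The matrix of the map has trace zero, so its square is scalar; \<open>0 < Im p\<close>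
  keeps its determinant away from zero.\<close>

lemma half_map_involution:
  assumes "cmod p = 1" "0 < Im p" "cnj p - z \<noteq> 0"
  shows "half_map p (half_map p z) = z"
proof -
  have pp: "(cnj p)\<^sup>2 - 1 \<noteq> 0"
  proof
    assume "(cnj p)\<^sup>2 - 1 = 0"
    then have "cnj p = 1 \<or> cnj p = -1" by (simp add: power2_eq_1_iff)
    then have "Im p = 0" by (auto simp: complex_eq_iff)
    with assms(2) show False by simp
  qed
  have 1: "1 - cnj p * half_map p z = ((cnj p)\<^sup>2 - 1) * z / (cnj p - z)"
    using assms(3) by (simp add: half_map_def field_simps power2_eq_square)
  have 2: "cnj p - half_map p z = ((cnj p)\<^sup>2 - 1) / (cnj p - z)"
    using assms(3) by (simp add: half_map_def field_simps power2_eq_square)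
  show ?thesis
    unfolding half_map_def[of p "half_map p z"] 1 2 using pp assms(3) by simp
qed

text \<open>With the denominator made real, \<open>z\<close> enters only through \<open>Re z\<close>
  and \<open>cmod z\<close>, so real and imaginary parts can be read off.\<close>

lemma half_map_numerator_times_cnj:
  assumes "cmod p = 1"
  shows "(1 - cnj p * z) * cnj (cnj p - z) = p - 2 * of_real (Re z) + cnj p * of_real ((cmod z)\<^sup>2)"
proof -
  have "(1 - cnj p * z) * cnj (cnj p - z) = p - (z * (cnj p * p) + cnj z) + cnj p * (z * cnj z)"
    by (simp add: algebra_simps)
  also have "z * (cnj p * p) + cnj z = 2 * of_real (Re z)"
    by (simp add: cnj_mult_self_eq_1[OF assms] complex_eq_iff)
  finally show ?thesis by (simp only: complex_norm_square)
qed

lemma half_map_in_half_plane: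
  assumes "cmod p = 1" "0 < Im p" "cmod z < 1"
  shows "0 < Im (half_map p z)"
proof -
  have "Im ((1 - cnj p * z) * cnj (cnj p - z)) = Im p * (1 - (cmod z)\<^sup>2)"
    unfolding half_map_numerator_times_cnj[OF assms(1)] by (simp del: of_real_power add: algebra_simps)
  moreover have "(cmod z)\<^sup>2 < 1" using assms(3) by (simp add: abs_square_less_1)
  moreover have "Im (half_map p z) = Im ((1 - cnj p * z) * cnj (cnj p - z)) / (cmod (cnj p - z))\<^sup>2"
    unfolding half_map_def by (simp add: Im_divide cmod_power2 algebra_simps)
  ultimately show ?thesis
    using assms half_map_denom_nonzero[OF assms(1,3)] by simp
qed

lemma half_map_in_disc:
  assumes "cmod p = 1" "0 < Im p" "0 < Im x"
  shows "cmod (half_map p x) < 1"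
proof -
  have "(cmod (cnj p - x))\<^sup>2 - (cmod (1 - cnj p * x))\<^sup>2
      = 4 * Im p * Im x + ((cmod p)\<^sup>2 - 1) * (1 - (cmod x)\<^sup>2)"
    unfolding cmod_power2 by (simp add: power2_eq_square algebra_simps)
  then have "(cmod (1 - cnj p * x))\<^sup>2 < (cmod (cnj p - x))\<^sup>2"
    using assms by (simp add: algebra_simps)
  then show ?thesis
    using half_map_denom_nonzero_half_plane[OF assms(2,3)]
    by (simp add: half_map_def norm_divide power2_less_imp_less)
qed

text \<open>Translates the half-plane distances that determine \<open>cmod t\<close> into the
  quantity inside \<open>rho\<close>.\<close>

lemma half_map_pseudo_distance:
  assumes "cmod p = 1" "0 < Im p" "cmod z < 1" "cmod w < 1"
  shows "cmod ((half_map p z - half_map p w) / (half_map p z - cnj (half_map p w)))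
    = cmod ((z - w) / (1 - cnj z * w))"
proof -
  have nz: "cnj p - z \<noteq> 0" "cnj p - w \<noteq> 0"
    using half_map_denom_nonzero assms by auto
  then have nz': "p - cnj w \<noteq> 0"
    by (metis complex_cnj_cnj complex_cnj_diff complex_cnj_zero)
  have n1: "half_map p z - half_map p w = (z - w) * (1 - (cnj p)\<^sup>2) / ((cnj p - z) * (cnj p - w))"
    using nz by (simp add: half_map_def field_simps power2_eq_square)
  have "half_map p z - cnj (half_map p w)
      = ((1 - cnj p * z) * (p - cnj w) - (1 - p * cnj w) * (cnj p - z)) / ((cnj p - z) * (p - cnj w))"
    using nz nz' by (simp add: half_map_def field_simps)
  also have "(1 - cnj p * z) * (p - cnj w) - (1 - p * cnj w) * (cnj p - z)
      = p - cnj p - (cnj p * p) * z - cnj w + (cnj p * p) * cnj w + z + (cnj p - p) * (z * cnj w)"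
    by (simp add: algebra_simps)
  also have "\<dots> = (p - cnj p) * (1 - z * cnj w)"
    unfolding cnj_mult_self_eq_1[OF assms(1)] by (simp add: algebra_simps)
  finally have n2: "half_map p z - cnj (half_map p w)
      = (p - cnj p) * (1 - z * cnj w) / ((cnj p - z) * (p - cnj w))" .
  have m1: "cmod (p - cnj w) = cmod (cnj p - w)"
    by (metis complex_cnj_cnj complex_cnj_diff complex_mod_cnj)
  have m2: "cmod (1 - z * cnj w) = cmod (1 - cnj z * w)"
    by (metis complex_cnj_cnj complex_cnj_diff complex_cnj_mult complex_cnj_one complex_mod_cnj)
  have "p - cnj p = p * (1 - (cnj p)\<^sup>2)"
    using cnj_mult_self_eq_1[OF assms(1)] by (simp add: algebra_simps power2_eq_square)
  then have m3: "cmod (p - cnj p) = cmod (1 - (cnj p)\<^sup>2)"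
    using assms(1) by (simp only: norm_mult)
  have "p - cnj p \<noteq> 0" using assms(2) by (auto simp: complex_eq_iff)
  then have "cmod (p - cnj p) \<noteq> 0" by simp
  then have m0: "cmod (1 - (cnj p)\<^sup>2) \<noteq> 0" unfolding m3 .
  show ?thesis
    unfolding n1 n2 norm_divide norm_mult m1 m2 m3 using m0 nz by (simp add: field_simps)
qed

lemma half_map_holomorphic: "cmod p = 1 \<Longrightarrow> half_map p holomorphic_on unit_disc"
  unfolding half_map_def [abs_def] using half_map_denom_nonzero
  by (intro holomorphic_intros) auto

lemma half_map_holomorphic_half_plane: "0 < Im p \<Longrightarrow> half_map p holomorphic_on {x. 0 < Im x}"
  unfolding half_map_def [abs_def] using half_map_denom_nonzero_half_plane
  by (intro holomorphic_intros) auto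

lemma open_upper_half_plane: "open {x. 0 < Im x}"
  by (intro open_Collect_less continuous_intros)

section \<open>Schwarz-Pick and the comparison of the two distances\<close>

lemma artanh_mono:
  fixes x y :: real
  assumes "0 \<le> x" "x \<le> y" "y < 1"
  shows "artanh x \<le> artanh y"
proof -
  have "(1 + x) / (1 - x) \<le> (1 + y) / (1 - y)"
    using assms by (intro frac_le) auto
  moreover have "0 < (1 + x) / (1 - x)" using assms by simp
  ultimately show ?thesis unfolding artanh_def by (simp add: ln_mono)
qed

lemma rho_0_left: "rho 0 t = artanh (cmod t)"
  by (simp add: rho_def)

lemma pseudo_distance_less_1:
  assumes "cmod a < 1" "cmod b < 1"
  shows "1 - cnj a * b \<noteq> 0" "cmod ((b - a) / (1 - cnj a * b)) < 1"
proof -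
  have "cmod (cnj a * b) < 1"
    using assms mult_strict_mono'[of "cmod a" 1 "cmod b" 1] by (simp add: norm_mult)
  then show nz: "1 - cnj a * b \<noteq> 0" by auto
  have "(cmod (1 - cnj a * b))\<^sup>2 - (cmod (b - a))\<^sup>2 = (1 - (cmod a)\<^sup>2) * (1 - (cmod b)\<^sup>2)"
    unfolding cmod_power2 by (simp add: power2_eq_square algebra_simps)
  also have "\<dots> > 0" using assms by (simp add: abs_square_less_1)
  finally have "cmod (b - a) < cmod (1 - cnj a * b)"
    by (simp add: power2_less_imp_less)
  then show "cmod ((b - a) / (1 - cnj a * b)) < 1" using nz by (simp add: norm_divide)
qed

text \<open>A disc automorphism moves \<open>h 0\<close> to the origin, and the Schwarz lemma
  applies to the composition \<open>k\<close>.\<close>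

lemma Schwarz_Pick_rho:
  assumes hol: "h holomorphic_on unit_disc" and im: "h ` unit_disc \<subseteq> unit_disc" and t: "cmod t < 1"
  shows "rho (h 0) (h t) \<le> rho 0 t"
proof -
  have h1: "cmod (h u) < 1" if "cmod u < 1" for u
    using im that by (force simp: image_subset_iff)
  define k where "k u = (h u - h 0) / (1 - cnj (h 0) * h u)" for u
  have "k holomorphic_on unit_disc"
    unfolding k_def using pseudo_distance_less_1(1) h1 by (intro holomorphic_intros hol) auto
  moreover have "k 0 = 0" by (simp add: k_def)
  moreover have "cmod (k u) < 1" if "cmod u < 1" for u
    unfolding k_def using h1 that by (intro pseudo_distance_less_1(2)) auto
  ultimately have "cmod (k t) \<le> cmod t" by (rule Schwarz_Lemma(1)[OF _ _ _ t])
  moreover have "rho (h 0) (h t) = artanh (cmod (k t))"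
    by (simp add: rho_def k_def norm_divide norm_minus_commute)
  ultimately show ?thesis using t by (simp add: rho_0_left artanh_mono)
qed

lemma hol_on_Cn_coordinate:
  fixes k :: "'n::finite"
  shows "hol_on_Cn (\<lambda>z. z $ k) D"
  unfolding hol_on_Cn_def
proof (intro ballI exI)
  fix z
  have "(\<Sum>i\<in>UNIV. axis k 1 $ i * h $ i) = h $ k" for h :: "complex ^ 'n"
    by (simp add: axis_def if_distrib[of "\<lambda>x. x * _"] cong: if_cong)
  then show "((\<lambda>z. z $ k) has_derivative (\<lambda>h. \<Sum>i\<in>UNIV. axis k 1 $ i * h $ i)) (at z within D)"
    by (simp add: bounded_linear_imp_has_derivative bounded_linear_vec_nth)
qed

lemma hol_on_Cn_mult:
  assumes "hol_on_Cn F D" "hol_on_Cn G D"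
  shows "hol_on_Cn (\<lambda>z. F z * G z) D"
  unfolding hol_on_Cn_def
proof
  fix z assume "z \<in> D"
  obtain c d where c: "(F has_derivative (\<lambda>h. \<Sum>i\<in>UNIV. c $ i * h $ i)) (at z within D)"
    and d: "(G has_derivative (\<lambda>h. \<Sum>i\<in>UNIV. d $ i * h $ i)) (at z within D)"
    using assms \<open>z \<in> D\<close> unfolding hol_on_Cn_def by blast
  have "((\<lambda>z. F z * G z) has_derivative
      (\<lambda>h. \<Sum>i\<in>UNIV. (\<chi> j. F z * d $ j + c $ j * G z) $ i * h $ i)) (at z within D)"
    by (rule has_derivative_eq_rhs[OF has_derivative_mult[OF c d]])
       (simp add: fun_eq_iff sum_distrib_left sum_distrib_right sum.distrib algebra_simps)
  then show "\<exists>c. ((\<lambda>z. F z * G z) has_derivative (\<lambda>h. \<Sum>i\<in>UNIV. c $ i * h $ i)) (at z within D)"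
    by blast
qed

lemma hol_on_Cn_compose:
  assumes "hol_on_Cn F D" "g holomorphic_on S" "open S" "F ` D \<subseteq> S"
  shows "hol_on_Cn (\<lambda>z. g (F z)) D"
  unfolding hol_on_Cn_def
proof
  fix z assume "z \<in> D"
  obtain c where c: "(F has_derivative (\<lambda>h. \<Sum>i\<in>UNIV. c $ i * h $ i)) (at z within D)"
    using assms(1) \<open>z \<in> D\<close> unfolding hol_on_Cn_def by blast
  have "(g has_derivative (*) (deriv g (F z))) (at (F z))"
    using holomorphic_derivI[OF assms(2,3), of "F z"] assms(4) \<open>z \<in> D\<close>
    by (auto simp: has_field_derivative_def)
  from has_derivative_compose[OF c this]
  have "((\<lambda>z. g (F z)) has_derivative
      (\<lambda>h. \<Sum>i\<in>UNIV. (\<chi> j. deriv g (F z) * c $ j) $ i * h $ i)) (at z within D)"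
    by (simp add: sum_distrib_left mult.assoc)
  then show "\<exists>c. ((\<lambda>z. g (F z)) has_derivative (\<lambda>h. \<Sum>i\<in>UNIV. c $ i * h $ i)) (at z within D)"
    by blast
qed

lemma hol_on_Cn_disc_map:
  assumes "hol_on_Cn F D" "f \<in> disc_maps D"
  shows "(\<lambda>u. F (f u)) holomorphic_on unit_disc"
proof (rule holomorphic_onI)
  fix t :: complex assume t: "t \<in> unit_disc"
  have fD: "f ` unit_disc \<subseteq> D" and hol: "\<And>i. (\<lambda>u. f u $ i) holomorphic_on unit_disc"
    using assms(2) by (auto simp: disc_maps_def)
  define d where "d i = deriv (\<lambda>u. f u $ i) t" for i
  have "((\<lambda>u. f u $ i) has_derivative (*) (d i)) (at t within unit_disc)" for i
    using holomorphic_derivI[OF hol _ t] by (simp add: d_def has_field_derivative_def)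
  then have "((\<lambda>u. f u $ i \<bullet> v) has_derivative (\<lambda>h. (d i * h) \<bullet> v)) (at t within unit_disc)" for i v
    by (rule has_derivative_inner_left)
  \<comment> \<open>The vector-valued derivative is assembled from real inner products with the
    basis vectors, to which the complex derivatives \<open>d i\<close> of the components
    contribute.\<close>
  then have df: "(f has_derivative (\<lambda>h. \<chi> i. d i * h)) (at t within unit_disc)"
    by (subst has_derivative_componentwise_within) (auto simp: Basis_vec_def inner_axis)
  obtain c where "(F has_derivative (\<lambda>h. \<Sum>i\<in>UNIV. c $ i * h $ i)) (at (f t) within D)"
    using assms(1) fD t unfolding hol_on_Cn_def by blast
  then have "(F has_derivative (\<lambda>h. \<Sum>i\<in>UNIV. c $ i * h $ i)) (at (f t) within f ` unit_disc)"
    by (rule has_derivative_subset[OF _ fD])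
  from has_derivative_in_compose[OF df this]
  have "((\<lambda>u. F (f u)) has_derivative (*) (\<Sum>i\<in>UNIV. c $ i * d i)) (at t within unit_disc)"
    by (rule has_derivative_eq_rhs) (simp add: fun_eq_iff sum_distrib_right mult.assoc)
  then show "(\<lambda>u. F (f u)) field_differentiable at t within unit_disc"
    by (auto simp: field_differentiable_def has_field_derivative_def)
qed

text \<open>The easy inequality: every competitor \<open>F\<close> composed with every competing
  disc \<open>f\<close> is a self-map of the disc, to which Schwarz-Pick applies.\<close>

lemma caratheodory_le_lempert: "caratheodory_dist D z w \<le> lempert_fun D z w"
  unfolding caratheodory_dist_def lempert_fun_def
proof (intro SUP_least INF_greatest)
  fix F t assume F: "F \<in> hol_to_disc D"
    and t: "t \<in> {t \<in> unit_disc. \<exists>f\<in>disc_maps D. f 0 = z \<and> f t = w}"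
  then obtain f where f: "f \<in> disc_maps D" "f 0 = z" "f t = w" by auto
  have "(\<lambda>u. F (f u)) ` unit_disc \<subseteq> unit_disc"
    using f(1) F by (auto simp: disc_maps_def hol_to_disc_def image_subset_iff)
  then have "rho (F (f 0)) (F (f t)) \<le> rho 0 t"
    using F f(1) t by (intro Schwarz_Pick_rho hol_on_Cn_disc_map) (auto simp: hol_to_disc_def)
  then show "ereal (rho (F z) (F w)) \<le> ereal (rho 0 t)" by (simp add: f)
qed

lemma rho_le_caratheodory: "F \<in> hol_to_disc D \<Longrightarrow> ereal (rho (F z) (F w)) \<le> caratheodory_dist D z w"
  unfolding caratheodory_dist_def by (rule SUP_upper)

lemma lempert_le_rho:
  assumes "f \<in> disc_maps D" "f 0 = z" "f t = w" "cmod t < 1"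
  shows "lempert_fun D z w \<le> ereal (artanh (cmod t))"
  unfolding lempert_fun_def
  by (rule INF_lower2[of t]) (use assms in \<open>auto simp: rho_0_left\<close>)

section \<open>Normal families and limits of disc maps\<close>

lemma holomorphic_disc_maps_subsequence:
  fixes h :: "nat \<Rightarrow> complex \<Rightarrow> complex"
  assumes hol: "\<And>n. h n holomorphic_on unit_disc" and im: "\<And>n u. cmod u < 1 \<Longrightarrow> cmod (h n u) < 1"
  obtains g r where "strict_mono (r :: nat \<Rightarrow> nat)" "g holomorphic_on unit_disc"
    "\<And>K. compact K \<Longrightarrow> K \<subseteq> unit_disc \<Longrightarrow> uniform_limit K (h \<circ> r) g sequentially"
proof -
  define H where "H = {k :: complex \<Rightarrow> complex. k holomorphic_on unit_disc \<and> (\<forall>u. cmod u < 1 \<longrightarrow> cmod (k u) < 1)}"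
  show thesis
  proof (rule Montel[of unit_disc H h])
    show "\<exists>B. \<forall>k\<in>H. \<forall>u\<in>K. cmod (k u) \<le> B" if "K \<subseteq> unit_disc" for K
      using that by (intro exI[of _ 1]) (force simp: H_def intro: less_imp_le)
  qed (use hol im that in \<open>auto simp: H_def\<close>)
qed

lemma uniform_limit_subseq:
  assumes "uniform_limit K f g sequentially" "strict_mono (r :: nat \<Rightarrow> nat)"
  shows "uniform_limit K (f \<circ> r) g sequentially"
  using assms(1) eventually_subseq[OF assms(2)] unfolding uniform_limit_iff o_def by fast

text \<open>A locally uniform limit that leaves the open disc is a unimodular constant, so the
  moduli tend to 1 uniformly on compact sets. This is the source of compact divergence.\<close>

lemma disc_maps_limit_dichotomy:
  fixes h :: "nat \<Rightarrow> complex \<Rightarrow> complex"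
  assumes im: "\<And>n u. cmod u < 1 \<Longrightarrow> cmod (h n u) < 1" and g: "g holomorphic_on unit_disc"
    and lim: "\<And>K. compact K \<Longrightarrow> K \<subseteq> unit_disc \<Longrightarrow> uniform_limit K h g sequentially"
  shows "(\<forall>u. cmod u < 1 \<longrightarrow> cmod (g u) < 1) \<or>
    (\<forall>K c. compact K \<longrightarrow> K \<subseteq> unit_disc \<longrightarrow> c < 1 \<longrightarrow> (\<forall>\<^sub>F n in sequentially. \<forall>u\<in>K. c < cmod (h n u)))"
proof (cases "\<forall>u. cmod u < 1 \<longrightarrow> cmod (g u) < 1")
  case False
  then obtain u0 where u0: "cmod u0 < 1" "1 \<le> cmod (g u0)" by (auto simp: not_less)
  have le1: "cmod (g u) \<le> 1" if "cmod u < 1" for u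
  proof -
    have "(\<lambda>n. h n u) \<longlonglongrightarrow> g u"
      by (rule tendsto_uniform_limitI[OF lim[of "{u}"]]) (use that in auto)
    then show ?thesis
      using im[OF that] by (intro tendsto_upperbound[OF tendsto_norm]) (auto intro: always_eventually less_imp_le)
  qed
  \<comment> \<open>By \<open>le1\<close> the modulus of \<open>g\<close> attains its maximum at the
    interior point \<open>u0\<close>.\<close>
  have "g constant_on unit_disc"
    by (rule maximum_modulus_principle[OF g, of unit_disc u0])
       (use u0 le1 in \<open>auto intro: order.trans\<close>)
  then have g1: "1 \<le> cmod (g u)" if "cmod u < 1" for u
    using u0 that unfolding constant_on_def by (metis mem_ball_0)
  have "\<forall>\<^sub>F n in sequentially. \<forall>u\<in>K. c < cmod (h n u)"
    if "compact K" "K \<subseteq> unit_disc" "c < 1" for K c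
  proof -
    have "\<forall>\<^sub>F n in sequentially. \<forall>u\<in>K. dist (h n u) (g u) < 1 - c"
      using uniform_limitD[OF lim[OF that(1,2)], of "1 - c"] that(3) by simp
    then show ?thesis
    proof (eventually_elim, intro ballI)
      fix n u assume "\<forall>u\<in>K. dist (h n u) (g u) < 1 - c" "u \<in> K"
      then have "cmod (g u - h n u) < 1 - c" "1 \<le> cmod (g u)"
        using g1 that(2) by (auto simp: dist_norm norm_minus_commute)
      then show "c < cmod (h n u)"
        using norm_triangle_ineq2[of "g u" "h n u"] by linarith
    qed
  qed
  then show ?thesis by blast
qed simp

lemma dist_vec2_le:
  fixes x y :: "complex ^ 2"
  shows "dist x y \<le> dist (x $ 1) (y $ 1) + dist (x $ 2) (y $ 2)"
  unfolding dist_vec_def using L2_set_le_sum[of UNIV "\<lambda>i. dist (x $ i) (y $ i)"] by (simp add: sum_2)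

lemma hol_on_Cn_imp_continuous_on: "hol_on_Cn F D \<Longrightarrow> continuous_on D F"
  unfolding hol_on_Cn_def continuous_on_eq_continuous_within
  by (meson has_derivative_continuous)

section \<open>The triangle and the half-plane model of \<open>D_ab a b\<close>\<close>

text \<open>
  In the triangle with sides \<open>a\<close>, \<open>b\<close>, \<open>1\<close> whose angles give \<open>p\<close> and \<open>q\<close>, the law of sines identifies
  \<open>s\<close> as the reciprocal of the diameter of the circumcircle.
\<close>

locale triangle_angles =
  fixes a b s :: real and p q :: complex
  assumes ab_pos: "0 < a" "0 < b" and s_pos: "0 < s"
    and norm_pq: "cmod p = 1" "cmod q = 1"
    and Im_pq: "Im p = a * s" "Im q = b * s"
    and Re_pq: "b * Re p = (1 - a\<^sup>2 + b\<^sup>2) / 2" "a * Re q = (1 + a\<^sup>2 - b\<^sup>2) / 2"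

lemma triangle_angles_exist:
  assumes "0 < a" "0 < b" "1 < a + b" "b < a + 1" "a < b + 1"
  obtains s p q where "triangle_angles a b s p q"
proof -
  \<comment> \<open>By Heron's formula \<open>T\<close> is sixteen times the squared area of the
    triangle. The factorization below shows that the triangle inequalities make it positive.\<close>
  define T where "T = 4 * b\<^sup>2 - (1 - a\<^sup>2 + b\<^sup>2)\<^sup>2"
  have "T = ((b + 1 - a) * (b + 1 + a)) * ((a + 1 - b) * (a + b - 1))"
    by (simp add: T_def power2_eq_square algebra_simps)
  then have "0 < T" using assms by (simp only:) (intro mult_pos_pos; simp)
  define s where "s = sqrt T / (2 * a * b)"
  have s2: "s\<^sup>2 = T / (4 * a\<^sup>2 * b\<^sup>2)"
    using \<open>0 < T\<close> by (simp add: s_def power_divide power_mult_distrib)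
  define p where "p = Complex ((1 - a\<^sup>2 + b\<^sup>2) / (2 * b)) (a * s)"
  define q where "q = Complex ((1 + a\<^sup>2 - b\<^sup>2) / (2 * a)) (b * s)"
  have "(cmod p)\<^sup>2 = 1"
    using assms(1,2) by (simp add: cmod_power2 p_def power_mult_distrib s2 power_divide)
      (simp add: T_def field_simps)
  moreover have "(cmod q)\<^sup>2 = 1"
    using assms(1,2) by (simp add: cmod_power2 q_def power_mult_distrib s2 power_divide)
      (simp add: T_def power2_eq_square field_simps)
  ultimately have "cmod p = 1" "cmod q = 1" by (simp_all add: power2_eq_1_iff) (smt (verit) norm_ge_zero)+
  then have "triangle_angles a b s p q"
    using assms(1,2) \<open>0 < T\<close> by unfold_locales (simp_all add: p_def q_def s_def)
  then show thesis by (rule that)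
qed

context triangle_angles
begin

lemma Im_pos: "0 < Im p" "0 < Im q"
  using ab_pos s_pos by (simp_all add: Im_pq)

text \<open>After clearing denominators, the laws of sines and cosines make the imaginary part of
  the product equal to \<open>s\<close> times the gap between the two squared moduli that define the
  domain.\<close>

lemma mem_D_ab_iff:
  "z \<in> D_ab a b \<longleftrightarrow> cmod (z $ 1) < 1 \<and> cmod (z $ 2) < 1 \<and>
    0 < Im (half_map p (z $ 1) * half_map q (z $ 2))"
proof -
  have "cmod (of_real a * x + of_real b * y - x * y) < cmod (of_real b * x + of_real a * y - 1)
      \<longleftrightarrow> 0 < Im (half_map p x * half_map q y)" if "cmod x < 1" "cmod y < 1" for x y
  proof -
    define P where "P = (1 - cnj p * x) * cnj (cnj p - x)"
    define Q where "Q = (1 - cnj q * y) * cnj (cnj q - y)"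
    define r where "r = (cmod x)\<^sup>2"
    define t where "t = (cmod y)\<^sup>2"
    have P: "Re P = Re p * (1 + r) - 2 * Re x" "Im P = a * s * (1 - r)"
      unfolding P_def half_map_numerator_times_cnj[OF norm_pq(1)] r_def
      by (simp_all del: of_real_power add: Im_pq algebra_simps)
    have Q: "Re Q = Re q * (1 + t) - 2 * Re y" "Im Q = b * s * (1 - t)"
      unfolding Q_def half_map_numerator_times_cnj[OF norm_pq(2)] t_def
      by (simp_all del: of_real_power add: Im_pq algebra_simps)
    \<comment> \<open>The identity needs \<open>a * Re q + b * Re p = 1\<close> and
      \<open>a * Re q - b * Re p = a\<^sup>2 - b\<^sup>2\<close>, both contained in
      \<open>Re_pq\<close>; the mixed terms in the product of \<open>x\<close> and
      \<open>cnj y\<close> cancel between the two squared moduli.\<close>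
    have "Im (P * Q) = s * ((1 - r) * (1 + t) * (a * Re q) + (1 + r) * (1 - t) * (b * Re p)
        - 2 * a * Re y * (1 - r) - 2 * b * Re x * (1 - t))"
      by (simp add: P Q algebra_simps)
    also have "\<dots> = s * ((cmod (of_real b * x + of_real a * y - 1))\<^sup>2
        - (cmod (of_real a * x + of_real b * y - x * y))\<^sup>2)"
      unfolding Re_pq r_def t_def cmod_power2 by (simp add: power2_eq_square field_simps)
    finally have PQ: "Im (P * Q) = s * ((cmod (of_real b * x + of_real a * y - 1))\<^sup>2
        - (cmod (of_real a * x + of_real b * y - x * y))\<^sup>2)" .
    have "half_map p x * half_map q y
        = ((1 - cnj p * x) * (1 - cnj q * y)) / ((cnj p - x) * (cnj q - y))"
      by (simp add: half_map_def)
    moreover have "((1 - cnj p * x) * (1 - cnj q * y)) * cnj ((cnj p - x) * (cnj q - y)) = P * Q"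
      by (simp add: P_def Q_def)
    ultimately have "Im (half_map p x * half_map q y)
        = Im (P * Q) / (cmod ((cnj p - x) * (cnj q - y)))\<^sup>2"
      by (simp only: Im_divide_cnj)
    moreover have "(cnj p - x) * (cnj q - y) \<noteq> 0"
      using half_map_denom_nonzero[OF norm_pq(1) that(1)] half_map_denom_nonzero[OF norm_pq(2) that(2)] by simp
    ultimately have "0 < Im (half_map p x * half_map q y) \<longleftrightarrow> 0 < Im (P * Q)"
      by (simp add: zero_less_divide_iff del: times_complex.sel)
    also have "\<dots> \<longleftrightarrow> (cmod (of_real a * x + of_real b * y - x * y))\<^sup>2
        < (cmod (of_real b * x + of_real a * y - 1))\<^sup>2"
      unfolding PQ using s_pos by (simp add: zero_less_mult_iff)
    also have "\<dots> \<longleftrightarrow> cmod (of_real a * x + of_real b * y - x * y) < cmod (of_real b * x + of_real a * y - 1)"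
      by (meson norm_ge_zero power2_less_imp_less power_strict_mono pos2)
    finally show ?thesis ..
  qed
  then show ?thesis unfolding D_ab_iff by auto
qed

definition third_coordinate :: "complex ^ 2 \<Rightarrow> complex" where
  "third_coordinate z = - 1 / (half_map p (z $ 1) * half_map q (z $ 2))"

lemma D_ab_half_plane:
  fixes z :: "complex ^ 2"
  assumes "z \<in> D_ab a b"
  shows "0 < Im (half_map p (z $ 1))" "0 < Im (half_map q (z $ 2))" "0 < Im (third_coordinate z)"
    "half_map p (z $ 1) * half_map q (z $ 2) * third_coordinate z = -1"
proof -
  have z: "cmod (z $ 1) < 1" "cmod (z $ 2) < 1" "0 < Im (half_map p (z $ 1) * half_map q (z $ 2))"
    using assms by (auto simp: mem_D_ab_iff)
  show "0 < Im (half_map p (z $ 1))" "0 < Im (half_map q (z $ 2))"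
    using z norm_pq Im_pos by (auto intro: half_map_in_half_plane)
  show "0 < Im (third_coordinate z)" unfolding third_coordinate_def using z(3) by (simp only: Im_minus_inverse_pos)
  show "half_map p (z $ 1) * half_map q (z $ 2) * third_coordinate z = -1"
    unfolding third_coordinate_def using Im_pos_nonzero[OF z(3)] by simp
qed

lemma coordinate_hol_to_disc: "(\<lambda>z. z $ 1) \<in> hol_to_disc (D_ab a b)" "(\<lambda>z. z $ 2) \<in> hol_to_disc (D_ab a b)"
  by (auto simp: hol_to_disc_def hol_on_Cn_coordinate mem_D_ab_iff)

lemma hol_on_Cn_third_coordinate: "hol_on_Cn third_coordinate (D_ab a b)"
  unfolding third_coordinate_def
proof (rule hol_on_Cn_compose[of _ _ "\<lambda>x. - 1 / x" "{x. 0 < Im x}"])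
  show "hol_on_Cn (\<lambda>z. half_map p (z $ 1) * half_map q (z $ 2)) (D_ab a b)"
    by (intro hol_on_Cn_mult hol_on_Cn_compose[OF hol_on_Cn_coordinate half_map_holomorphic] norm_pq)
       (auto simp: mem_D_ab_iff)
  show "(\<lambda>x. - 1 / x) holomorphic_on {x. 0 < Im x}"
    by (intro holomorphic_intros) auto
  show "(\<lambda>z. half_map p (z $ 1) * half_map q (z $ 2)) ` D_ab a b \<subseteq> {x. 0 < Im x}"
    by (auto simp: mem_D_ab_iff simp del: times_complex.sel)
qed (rule open_upper_half_plane)

text \<open>Brought back to the disc, the third coordinate becomes a competitor for the Caratheodory
  distance.\<close>

lemma third_coordinate_hol_to_disc: "(\<lambda>z. half_map \<i> (third_coordinate z)) \<in> hol_to_disc (D_ab a b)"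
proof -
  have "hol_on_Cn (\<lambda>z. half_map \<i> (third_coordinate z)) (D_ab a b)"
    by (rule hol_on_Cn_compose[OF hol_on_Cn_third_coordinate half_map_holomorphic_half_plane open_upper_half_plane])
       (use D_ab_half_plane(3) in auto)
  then show ?thesis
    using D_ab_half_plane(3) half_map_in_disc[of \<i>] by (auto simp: hol_to_disc_def)
qed

section \<open>Extremal discs and connectedness\<close>

text \<open>The value \<open>artanh (cmod t)\<close> is the hyperbolic distance of \<open>z\<close>
  and \<open>w\<close> in one of the three coordinates, and each coordinate yields a competitor for
  the Caratheodory distance.\<close>

lemma extremal_disc:
  assumes z: "z \<in> D_ab a b" and w: "w \<in> D_ab a b"
  obtains t f where "cmod t < 1" "f \<in> disc_maps (D_ab a b)" "f 0 = z" "f t = w"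
    "ereal (artanh (cmod t)) \<le> caratheodory_dist (D_ab a b) z w"
proof (cases "z = w")
  case True
  \<comment> \<open>Since \<open>rho\<close> vanishes at equal points, this bounds the distance
    below by 0, which suffices for a constant disc with \<open>t = 0\<close>.\<close>
  have "ereal (rho (z $ 1) (z $ 1)) \<le> caratheodory_dist (D_ab a b) z z"
    by (rule rho_le_caratheodory[OF coordinate_hol_to_disc(1)])
  then show thesis
    using z True by (intro that[of 0 "\<lambda>_. z"]) (auto simp: disc_maps_def rho_def)
next
  case False
  note Z = D_ab_half_plane[OF z] and W = D_ab_half_plane[OF w]
  have norms: "cmod (z $ 1) < 1" "cmod (z $ 2) < 1" "cmod (w $ 1) < 1" "cmod (w $ 2) < 1"
    using z w by (auto simp: mem_D_ab_iff)
  have invol: "half_map p (half_map p x) = x" "half_map q (half_map q x) = x" if "cmod x < 1" for x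
    using that norm_pq Im_pos half_map_denom_nonzero by (simp_all add: half_map_involution)
  have invol': "half_map r (half_map r x) = x" if "cmod r = 1" "0 < Im r" "0 < Im x" for x r
    using that half_map_denom_nonzero_half_plane by (simp add: half_map_involution)
  have "z $ 1 \<noteq> w $ 1 \<or> z $ 2 \<noteq> w $ 2"
    using False by (metis (full_types) exhaust_2 vec_eq_iff)
  then have ne: "half_map p (z $ 1) \<noteq> half_map p (w $ 1) \<or> half_map q (z $ 2) \<noteq> half_map q (w $ 2)"
    using invol norms by metis
  obtain t g1 g2 where t: "cmod t < 1"
    "cmod t = cmod ((half_map p (z $ 1) - half_map p (w $ 1)) / (half_map p (z $ 1) - cnj (half_map p (w $ 1))))
      \<or> cmod t = cmod ((half_map q (z $ 2) - half_map q (w $ 2)) / (half_map q (z $ 2) - cnj (half_map q (w $ 2))))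
      \<or> cmod t = cmod ((third_coordinate z - third_coordinate w) / (third_coordinate z - cnj (third_coordinate w)))"
    and g: "g1 holomorphic_on unit_disc" "g2 holomorphic_on unit_disc"
      "g1 0 = half_map p (z $ 1)" "g2 0 = half_map q (z $ 2)"
      "g1 t = half_map p (w $ 1)" "g2 t = half_map q (w $ 2)"
      "\<And>u. cmod u < 1 \<Longrightarrow> 0 < Im (g1 u)" "\<And>u. cmod u < 1 \<Longrightarrow> 0 < Im (g2 u)"
      "\<And>u. cmod u < 1 \<Longrightarrow> 0 < Im (g1 u * g2 u)"
    using disc_through_two_triples[OF Z(1-3) W(1-3) Z(4) W(4) ne] by metis
  define F where "F u = half_map \<i> (third_coordinate u)" for u
  have F1: "cmod (F z) < 1" "cmod (F w) < 1" and F2: "half_map \<i> (F z) = third_coordinate z" "half_map \<i> (F w) = third_coordinate w"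
    using half_map_in_disc[of \<i>] invol'[of \<i>] Z(3) W(3) by (simp_all add: F_def)
  have "artanh (cmod t) \<in> {rho (z $ 1) (w $ 1), rho (z $ 2) (w $ 2), rho (F z) (F w)}"
    using t(2) half_map_pseudo_distance[OF norm_pq(1) Im_pos(1) norms(1,3)]
      half_map_pseudo_distance[OF norm_pq(2) Im_pos(2) norms(2,4)]
      half_map_pseudo_distance[of \<i>, OF _ _ F1]
    by (auto simp: rho_def F2)
  then have le: "ereal (artanh (cmod t)) \<le> caratheodory_dist (D_ab a b) z w"
    using rho_le_caratheodory[OF coordinate_hol_to_disc(1), of z w]
      rho_le_caratheodory[OF coordinate_hol_to_disc(2), of z w]
      rho_le_caratheodory[OF third_coordinate_hol_to_disc, of z w, folded F_def] by auto
  \<comment> \<open>The disc in the half-plane model is carried back by the same involutions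
    \<open>half_map p\<close> and \<open>half_map q\<close>.\<close>
  define f :: "complex \<Rightarrow> complex ^ 2"
    where "f u = (\<chi> i. if i = 1 then half_map p (g1 u) else half_map q (g2 u))" for u
  have f1: "f u $ 1 = half_map p (g1 u)" and f2: "f u $ 2 = half_map q (g2 u)" for u
    by (simp_all add: f_def)
  have "(\<lambda>u. f u $ i) holomorphic_on unit_disc" for i
  proof -
    have "(\<lambda>u. half_map p (g1 u)) holomorphic_on unit_disc"
      using g(7)
      by (intro holomorphic_on_compose_gen
          [OF g(1) half_map_holomorphic_half_plane[OF Im_pos(1)], unfolded o_def]) auto
    moreover have "(\<lambda>u. half_map q (g2 u)) holomorphic_on unit_disc"
      using g(8)
      by (intro holomorphic_on_compose_gen
          [OF g(2) half_map_holomorphic_half_plane[OF Im_pos(2)], unfolded o_def]) auto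
    ultimately show ?thesis using exhaust_2[of i] by (auto simp: f1 f2)
  qed
  moreover have "f u \<in> D_ab a b" if "cmod u < 1" for u
    unfolding mem_D_ab_iff f1 f2
    using that g(7-9) norm_pq Im_pos by (simp add: half_map_in_disc invol' del: times_complex.sel)
  ultimately have f: "f \<in> disc_maps (D_ab a b)" by (auto simp: disc_maps_def)
  have "f 0 = z" "f t = w"
    using norms by (simp_all add: vec_eq_iff forall_2 f1 f2 g(3-6) invol)
  with t(1) f show thesis using le by (rule that)
qed

lemma open_D_ab: "open (D_ab a b)"
proof -
  have "D_ab a b = {z. cmod (z $ 1) < 1} \<inter> {z. cmod (z $ 2) < 1} \<inter>
     {z. cmod (of_real a * z $ 1 + of_real b * z $ 2 - z $ 1 * z $ 2)
       < cmod (of_real b * z $ 1 + of_real a * z $ 2 - 1)}"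
    by (auto simp: D_ab_iff)
  also have "open \<dots>"
    by (intro open_Int open_Collect_less continuous_intros)
  finally show ?thesis .
qed

text \<open>Any two points lie on the image of an analytic disc inside the domain, which gives
  connectedness.\<close>

lemma complex_domain_D_ab: "complex_domain (D_ab a b)"
proof -
  have "connected_component (D_ab a b) z w" if zw: "z \<in> D_ab a b" "w \<in> D_ab a b" for z w
  proof -
    obtain t f where f: "cmod t < 1" "f \<in> disc_maps (D_ab a b)" "f 0 = z" "f t = w"
      by (rule extremal_disc[OF zw])
    have "continuous_on unit_disc (\<lambda>u. f u $ i)" for i
      using f(2) by (auto simp: disc_maps_def intro: holomorphic_on_imp_continuous_on)
    then have "continuous_on unit_disc f"
      using continuous_on_vec_lambda[of unit_disc "\<lambda>i u. f u $ i"] by simp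
    then have "connected (f ` unit_disc)" by (rule connected_continuous_image) simp
    moreover have "f ` unit_disc \<subseteq> D_ab a b" using f(2) by (simp add: disc_maps_def)
    moreover have "z \<in> f ` unit_disc" "w \<in> f ` unit_disc"
      using f by (force intro: rev_image_eqI[of 0], force intro: rev_image_eqI[of t])
    ultimately show ?thesis unfolding connected_component_def by blast
  qed
  moreover have "0 \<in> D_ab a b" by (simp add: D_ab_iff)
  ultimately show ?thesis
    using open_D_ab by (auto simp: complex_domain_def connected_iff_connected_component)
qed

section \<open>Tautness and equality of the two distances\<close>

lemma taut_D_ab: "taut_domain (D_ab a b)"
  unfolding taut_domain_def
proof (intro conjI allI impI complex_domain_D_ab)
  fix f :: "nat \<Rightarrow> complex \<Rightarrow> complex ^ 2"
  assume f: "\<forall>k. f k \<in> disc_maps (D_ab a b)"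
  have fD: "f k u \<in> D_ab a b" if "cmod u < 1" for k u
    using f that by (auto simp: disc_maps_def image_subset_iff)
  \<comment> \<open>Every index from 2 on gives the third coordinate, so statements about the three
    coordinates can range over all natural \<open>j\<close>.\<close>
  define F where "F j z = (if j = 0 then z $ 1 else if j = 1 then z $ 2 else half_map \<i> (third_coordinate z))"
    for j :: nat and z
  have F: "F j \<in> hol_to_disc (D_ab a b)" for j
    unfolding F_def using coordinate_hol_to_disc third_coordinate_hol_to_disc by (cases "j = 0"; cases "j = 1") simp_all
  have hol: "(\<lambda>u. F j (f k u)) holomorphic_on unit_disc" for j k
    by (rule hol_on_Cn_disc_map[where D = "D_ab a b"]) (use F[of j] f in \<open>auto simp: hol_to_disc_def\<close>)
  have im: "cmod (F j (f k u)) < 1" if "cmod u < 1" for j k u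
    using F[of j] fD[OF that, of k] by (auto simp: hol_to_disc_def image_subset_iff)
  obtain g0 r0 where 0: "strict_mono (r0 :: nat \<Rightarrow> nat)" "g0 holomorphic_on unit_disc"
    "\<And>K. compact K \<Longrightarrow> K \<subseteq> unit_disc \<Longrightarrow> uniform_limit K ((\<lambda>k u. F 0 (f k u)) \<circ> r0) g0 sequentially"
    by (rule holomorphic_disc_maps_subsequence[of "\<lambda>k u. F 0 (f k u)"]) (use hol im in auto)
  obtain g1 r1 where 1: "strict_mono (r1 :: nat \<Rightarrow> nat)" "g1 holomorphic_on unit_disc"
    "\<And>K. compact K \<Longrightarrow> K \<subseteq> unit_disc \<Longrightarrow> uniform_limit K ((\<lambda>k u. F 1 (f (r0 k) u)) \<circ> r1) g1 sequentially"
    by (rule holomorphic_disc_maps_subsequence[of "\<lambda>k u. F 1 (f (r0 k) u)"]) (use hol im in auto)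
  obtain g2 r2 where 2: "strict_mono (r2 :: nat \<Rightarrow> nat)" "g2 holomorphic_on unit_disc"
    "\<And>K. compact K \<Longrightarrow> K \<subseteq> unit_disc \<Longrightarrow> uniform_limit K ((\<lambda>k u. F 2 (f (r0 (r1 k)) u)) \<circ> r2) g2 sequentially"
    by (rule holomorphic_disc_maps_subsequence[of "\<lambda>k u. F 2 (f (r0 (r1 k)) u)"]) (use hol im in auto)
  define r where "r = r0 \<circ> (r1 \<circ> r2)"
  define g where "g j = (if j = 0 then g0 else if j = 1 then g1 else g2)" for j :: nat
  have r: "strict_mono r" unfolding r_def by (intro strict_mono_o 0 1 2)
  have ghol: "g j holomorphic_on unit_disc" for j using 0 1 2 by (simp add: g_def)
  have lim: "uniform_limit K (\<lambda>k u. F j (f (r k) u)) (g j) sequentially"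
    if "compact K" "K \<subseteq> unit_disc" for K j
  proof -
    have "F j = F 2" if "j \<noteq> 0" "j \<noteq> 1" using that by (auto simp: F_def)
    then show ?thesis
      using uniform_limit_subseq[OF 0(3)[OF that] strict_mono_o[OF 1(1) 2(1)]]
        uniform_limit_subseq[OF 1(3)[OF that] 2(1)] 2(3)[OF that]
      by (cases "j = 0"; cases "j = 1") (simp_all add: g_def r_def o_def)
  qed
  show "\<exists>r. strict_mono r \<and> ((\<exists>g\<in>disc_maps (D_ab a b). loc_unif_conv_disc (f \<circ> r) g) \<or>
      compactly_divergent (D_ab a b) (f \<circ> r))"
  proof (cases "\<forall>j u. cmod u < 1 \<longrightarrow> cmod (g j u) < 1")
    case True
    define G :: "complex \<Rightarrow> complex ^ 2" where "G u = (\<chi> i. if i = 1 then g 0 u else g 1 u)" for u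
    have G1: "G u $ 1 = g 0 u" and G2: "G u $ 2 = g 1 u" for u by (simp_all add: G_def)
    have "G u \<in> D_ab a b" if u: "cmod u < 1" for u
    proof -
      have lims: "(\<lambda>k. F j (f (r k) u)) \<longlonglongrightarrow> g j u" for j
        by (rule tendsto_uniform_limitI[OF lim[of "{u}"]]) (use u in auto)
      have hm: "(\<lambda>k. half_map v (F j (f (r k) u))) \<longlonglongrightarrow> half_map v (g j u)"
        if "cmod v = 1" for v j
        using half_map_denom_nonzero[OF that] True u unfolding half_map_def
        by (intro tendsto_intros lims) auto
      \<comment> \<open>The open condition defining the domain could degenerate in the limit,
        whereas the equation for the product is closed. It passes to the limit, and the third
        factor, still strictly inside the half-plane, restores the strict inequality.\<close>
      have "half_map p (F 0 (f k u)) * half_map q (F 1 (f k u)) * half_map \<i> (F 2 (f k u)) = -1" for k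
        using D_ab_half_plane[OF fD[OF u, of k]] half_map_denom_nonzero_half_plane[of \<i>]
        by (simp add: F_def half_map_involution)
      with tendsto_mult[OF tendsto_mult[OF hm[OF norm_pq(1), of 0] hm[OF norm_pq(2), of 1]] hm[of \<i> 2]]
      have prod: "half_map p (g 0 u) * half_map q (g 1 u) * half_map \<i> (g 2 u) = -1"
        by (simp add: LIMSEQ_const_iff)
      have "0 < Im (half_map \<i> (g 2 u))"
        using half_map_in_half_plane[of \<i>] True u by simp
      then have "0 < Im (half_map p (g 0 u) * half_map q (g 1 u))"
        unfolding eq_minus_inverse[OF prod] by (rule Im_minus_inverse_pos)
      then show ?thesis unfolding mem_D_ab_iff G1 G2 using True u by blast
    qed
    moreover have "(\<lambda>u. G u $ i) holomorphic_on unit_disc" for i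
      using exhaust_2[of i] ghol by (auto simp: G1 G2)
    ultimately have "G \<in> disc_maps (D_ab a b)" by (auto simp: disc_maps_def)
    moreover have "loc_unif_conv_disc (f \<circ> r) G"
      unfolding loc_unif_conv_disc_def
    proof
      fix t :: complex assume "t \<in> unit_disc"
      then obtain d where d: "0 < d" "cball t d \<subseteq> unit_disc"
        using open_contains_cball open_ball by metis
      have "uniform_limit (cball t d) (f \<circ> r) G sequentially"
        unfolding uniform_limit_iff
      proof (intro allI impI)
        fix e :: real assume "0 < e"
        have "\<forall>\<^sub>F k in sequentially. \<forall>u\<in>cball t d. dist (F j (f (r k) u)) (g j u) < e / 2" for j
          by (rule uniform_limitD[OF lim[OF compact_cball d(2)]]) (use \<open>0 < e\<close> in simp)
        from this[of 0] this[of 1]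
        show "\<forall>\<^sub>F k in sequentially. \<forall>u\<in>cball t d. dist ((f \<circ> r) k u) (G u) < e"
        proof (eventually_elim, intro ballI)
          fix k u
          assume "\<forall>u\<in>cball t d. dist (F 0 (f (r k) u)) (g 0 u) < e / 2"
            "\<forall>u\<in>cball t d. dist (F 1 (f (r k) u)) (g 1 u) < e / 2" "u \<in> cball t d"
          then have "dist (F 0 (f (r k) u)) (g 0 u) < e / 2" "dist (F 1 (f (r k) u)) (g 1 u) < e / 2"
            by blast+
          then show "dist ((f \<circ> r) k u) (G u) < e"
            using dist_vec2_le[of "f (r k) u" "G u"] by (simp add: F_def G1 G2)
        qed
      qed
      then have "uniform_limit (ball t d \<inter> unit_disc) (f \<circ> r) G sequentially"
        by (rule uniform_limit_on_subset) auto
      with d(1) show "\<exists>d>0. uniform_limit (ball t d \<inter> unit_disc) (f \<circ> r) G sequentially" by blast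
    qed
    ultimately show ?thesis using r by blast
  next
    case False
    then obtain j where j: "\<not> (\<forall>u. cmod u < 1 \<longrightarrow> cmod (g j u) < 1)" by blast
    with disc_maps_limit_dichotomy[of "\<lambda>k u. F j (f (r k) u)", OF im ghol lim]
    have ev: "\<forall>\<^sub>F k in sequentially. \<forall>u\<in>K. c < cmod (F j (f (r k) u))"
      if "compact K" "K \<subseteq> unit_disc" "c < 1" for K c using that by blast
    have "compactly_divergent (D_ab a b) (f \<circ> r)"
      unfolding compactly_divergent_def
    proof (intro allI impI, elim conjE)
      fix K L assume K: "compact K" "K \<subseteq> unit_disc" and L: "compact L" "L \<subseteq> D_ab a b"
      \<comment> \<open>On the compact set \<open>L\<close> the modulus of \<open>F j\<close> stays
        below some \<open>c < 1\<close>, while along the sequence it eventually exceeds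
        \<open>c\<close> on \<open>K\<close>.\<close>
      have "\<exists>c<1. \<forall>z\<in>L. cmod (F j z) \<le> c"
      proof (cases "L = {}")
        case True
        then show ?thesis by (auto intro: exI[of _ 0])
      next
        case False
        have "continuous_on L (\<lambda>z. cmod (F j z))"
          using F[of j] L(2) by (auto simp: hol_to_disc_def intro!: continuous_intros
            intro: continuous_on_subset hol_on_Cn_imp_continuous_on)
        from continuous_attains_sup[OF L(1) False this]
        obtain z where "z \<in> L" "\<forall>y\<in>L. cmod (F j y) \<le> cmod (F j z)" by blast
        moreover have "cmod (F j z) < 1"
          using F[of j] L(2) \<open>z \<in> L\<close> by (auto simp: hol_to_disc_def image_subset_iff)
        ultimately show ?thesis by blast
      qed
      then obtain c where c: "c < 1" "\<And>z. z \<in> L \<Longrightarrow> cmod (F j z) \<le> c" by blast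
      from ev[OF K c(1)] show "\<forall>\<^sub>F k in sequentially. (f \<circ> r) k ` K \<inter> L = {}"
        by eventually_elim (use c(2) in \<open>fastforce simp: not_le[symmetric]\<close>)
    qed
    then show ?thesis using r by blast
  qed
qed

lemma lempert_domain_D_ab: "lempert_domain (D_ab a b)"
  unfolding lempert_domain_def
proof (intro conjI ballI taut_D_ab antisym caratheodory_le_lempert)
  fix z w assume zw: "z \<in> D_ab a b" "w \<in> D_ab a b"
  obtain t f where f: "cmod t < 1" "f \<in> disc_maps (D_ab a b)" "f 0 = z" "f t = w"
    "ereal (artanh (cmod t)) \<le> caratheodory_dist (D_ab a b) z w"
    by (rule extremal_disc[OF zw])
  then show "lempert_fun (D_ab a b) z w \<le> caratheodory_dist (D_ab a b) z w"
    using lempert_le_rho order.trans by blast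
qed

end

theorem theorem19:
  fixes a b :: real
  assumes "a > 0" and "b > 0"
    and "a + b > 1" and "a + 1 > b" and "b + 1 > a"
  shows "lempert_domain (D_ab a b)"
proof -
  obtain s p q where "triangle_angles a b s p q"
    using triangle_angles_exist assms by blast
  then show ?thesis by (rule triangle_angles.lempert_domain_D_ab)
qed

end
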